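(* Let $\mathcal{D}\subset\mathbb{R}^n$ be open, $F:\mathcal{D}\to\mathbb{R}^m$ a smooth map, $p=(x,y)\in\mathcal{D}\times\mathbb{R}^m$, and $A=\mathrm{d}F|_x$. Let $\lambda_1,\ldots,\lambda_r>0$ be the nonzero singular values of $A$ ($r=\operatorname{rank}A$), and let $\Theta=\Theta(F)|_p$. Let $\Gamma_A=\{(v,Av):v\in\mathbb{R}^n\}\subset\mathbb{R}^n\oplus\mathbb{R}^m$ be the graph of $A$, oriented by projection to $\mathbb{R}^n$. If $$\mathcal{S}(\lambda)=\sum_{i=1}^r\frac{\lambda_i^2}{1+\lambda_i^2}<1,$$ then $\Gamma_A$ is the unique calibrated oriented $n$-plane of $\Theta$, i.e. the unique oriented $n$-dimensional linear subspace $P\subset\mathbb{R}^n\oplus\mathbb{R}^m$ with $\Theta(P)=1$.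
   Context: For an oriented $n$-plane $P$ in a Euclidean space and an $n$-form $\omega$, $\omega(P)$ denotes the value of $\omega$ on $e_1\wedge\cdots\wedge e_n$ for any oriented orthonormal basis $e_1,\dots,e_n$ of $P$. An oriented $n$-plane $P$ is calibrated by a form $\omega$ of comass one if $\omega(P)=1$ (comass: $\|\omega\|=\sup|\omega(\xi)|$ over unit simple $n$-vectors $\xi$). The Tsai–Wang form $\Theta(F)$: this is an $n$-form on $\mathcal{D}\times\mathbb{R}^m$. Its value at $p=(x,y)$ depends only on $\mathrm{d}F|_x$ and is given as follows. Choose oriented orthonormal linear coordinates $x_1,\ldots,x_n$ on $\mathbb{R}^n$ and orthonormal linear coordinates $y_1,\ldots,y_m$ on $\mathbb{R}^m$ (no orientation prescribed) adapted to the singular value decomposition of $\mathrm{d}F|_x$: $\mathrm{d}F|_x(\partial/\partial x_i)=\lambda_i\,\partial/\partial y_i$ for $1\le i\le r$ and $\mathrm{d}F|_x(\partial/\partial x_i)=0$ for $i>r$, with $\lambda_1,\ldots,\lambda_r>0$. Put $\widehat{\mathrm{d}x_i}=\mathrm{d}x_1\wedge\cdots\wedge\mathrm{d}x_{i-1}\wedge\mathrm{d}x_{i+1}\wedge\cdots\wedge\mathrm{d}x_n$ and $\mathcal{C}(\lambda)=\sqrt{\prod_{i=1}^r(1+\lambda_i^2)}$, $\mathcal{S}(\lambda)=\sum_{i=1}^r\frac{\lambda_i^2}{1+\lambda_i^2}$. Then $$\Theta(F)|_p=\mathcal{C}(\lambda)\Bigl((1-\mathcal{S}(\lambda))\,\mathrm{d}x_1\wedge\cdots\wedge\mathrm{d}x_n+\sum_{i=1}^{r}(-1)^{i-1}\frac{\lambda_i}{1+\lambda_i^2}\,\mathrm{d}y_i\wedge\widehat{\mathrm{d}x_i}\Bigr).$$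 *)

theory Defs
  imports "HOL-Analysis.Analysis" "Jordan_Normal_Form.Determinant"
begin

section \<open>Alternating forms and oriented subspaces\<close>

text \<open>
  Frames, coordinate systems and the arguments of an \<open>n\<close>-form are lists, numbered from \<open>0\<close>.
  An \<open>n\<close>-form is a function of a list of \<open>n\<close> vectors; its values on lists of any other length
  play no role.
\<close>

type_synonym 'a form = "'a list \<Rightarrow> real"

definition wedge :: "('a \<Rightarrow> real) list \<Rightarrow> 'a form" where
  "wedge \<alpha>s vs =
     Determinant.det (mat (length \<alpha>s) (length \<alpha>s) (\<lambda>(i, j). (\<alpha>s ! i) (vs ! j)))"

definition orthonormal_list :: "'a::real_inner list \<Rightarrow> bool" where
  "orthonormal_list es \<longleftrightarrow>
     (\<forall>i < length es. \<forall>j < length es. inner (es ! i) (es ! j) = (if i = j then 1 else 0))"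

definition ordered_basis :: "'a::real_vector set \<Rightarrow> 'a list \<Rightarrow> bool" where
  "ordered_basis P bs \<longleftrightarrow> distinct bs \<and> independent (set bs) \<and> span (set bs) = P"

definition same_orientation :: "'a::real_vector list \<Rightarrow> 'a list \<Rightarrow> bool" where
  "same_orientation bs cs \<longleftrightarrow> length cs = length bs \<and>
     (\<exists>M \<in> carrier_mat (length bs) (length bs). Determinant.det M > 0 \<and>
        (\<forall>i < length bs. cs ! i = (\<Sum>j < length bs. (M $$ (i, j)) *\<^sub>R (bs ! j))))"

text \<open>
  An oriented subspace is a subspace together with an orientation, i.e. an equivalence class of
  ordered bases; the second component is the set of all positively oriented ordered bases.
\<close>

type_synonym 'a oriented = "'a set \<times> 'a list set"

definition oriented_plane :: "nat \<Rightarrow> 'a::euclidean_space oriented \<Rightarrow> bool" where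
  "oriented_plane n P \<longleftrightarrow> subspace (fst P) \<and> dim (fst P) = n \<and>
     (\<exists>bs. ordered_basis (fst P) bs \<and>
        snd P = {cs. ordered_basis (fst P) cs \<and> same_orientation bs cs})"

text \<open>
  The value of a form on an oriented plane; for an alternating form of the right degree it does
  not depend on the chosen oriented orthonormal basis.
\<close>

definition form_value :: "'a::euclidean_space form \<Rightarrow> 'a oriented \<Rightarrow> real" where
  "form_value \<omega> P = \<omega> (SOME es. es \<in> snd P \<and> orthonormal_list es)"

text \<open>
  The squared norm of the simple vector \<open>v\<^sub>1 \<and> \<dots> \<and> v\<^sub>k\<close> is the Gram determinant of
  \<open>v\<^sub>1, \<dots>, v\<^sub>k\<close>, which is the value on \<open>v\<^sub>1, \<dots>, v\<^sub>k\<close> of the wedge product of the dual covectors.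
\<close>

definition simple_norm :: "'a::euclidean_space list \<Rightarrow> real" where
  "simple_norm vs = sqrt (wedge (map inner vs) vs)"

definition comass :: "nat \<Rightarrow> 'a::euclidean_space form \<Rightarrow> real" where
  "comass n \<omega> = Sup {\<bar>\<omega> vs\<bar> | vs. length vs = n \<and> simple_norm vs = 1}"

definition calibrated_plane :: "nat \<Rightarrow> 'a::euclidean_space form \<Rightarrow> 'a oriented \<Rightarrow> bool" where
  "calibrated_plane n \<omega> P \<longleftrightarrow> comass n \<omega> = 1 \<and> oriented_plane n P \<and> form_value \<omega> P = 1"


section \<open>Smooth maps\<close>

primrec Ck_on ::
    "nat \<Rightarrow> ('a::real_normed_vector \<Rightarrow> 'b::real_normed_vector) \<Rightarrow> 'a set \<Rightarrow> bool" where
  "Ck_on 0 F D \<longleftrightarrow> continuous_on D F"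
| "Ck_on (Suc k) F D \<longleftrightarrow> (\<forall>x \<in> D. F differentiable (at x)) \<and>
     (\<forall>v. Ck_on k (\<lambda>x. frechet_derivative F (at x) v) D)"

definition smooth_map_on ::
    "('a::real_normed_vector \<Rightarrow> 'b::real_normed_vector) \<Rightarrow> 'a set \<Rightarrow> bool" where
  "smooth_map_on F D \<longleftrightarrow> (\<forall>k. Ck_on k F D)"


section \<open>The standard orientation and graphs\<close>

text \<open>The linear order on the index type numbers the coordinates and so orients the space.\<close>

definition standard_basis :: "(real ^ 'n::{finite,linorder}) list" where
  "standard_basis = map (\<lambda>i. axis i 1) (sorted_list_of_set UNIV)"

definition graph_plane ::
    "(real ^ 'n::{finite,linorder} \<Rightarrow> real ^ 'm) \<Rightarrow>
     ((real ^ 'n::_) \<times> (real ^ 'm)) oriented" where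
  "graph_plane A =
     (let \<Gamma> = range (\<lambda>v. (v, A v))
      in (\<Gamma>, {bs. ordered_basis \<Gamma> bs \<and> same_orientation standard_basis (map fst bs)}))"


section \<open>Singular values and the Tsai--Wang form\<close>

text \<open>
  \<open>ls\<close> lists the nonzero singular values of \<open>A\<close> with multiplicity, in some order: the multiplicity
  of \<open>\<sigma>\<close> is that of the eigenvalue \<open>\<sigma>\<^sup>2\<close> of the self-adjoint map \<open>A\<^sup>* A\<close>.
\<close>

definition nonzero_singular_values ::
    "('a::euclidean_space \<Rightarrow> 'b::euclidean_space) \<Rightarrow> real list \<Rightarrow> bool" where
  "nonzero_singular_values A ls \<longleftrightarrow>
     (\<forall>\<sigma>. count_list ls \<sigma> = (if \<sigma> > 0 then dim {v. adjoint A (A v) = \<sigma>\<^sup>2 *\<^sub>R v} else 0))"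

definition tw_C :: "real list \<Rightarrow> real" where
  "tw_C ls = sqrt (\<Prod>i < length ls. 1 + (ls ! i)\<^sup>2)"

definition tw_S :: "real list \<Rightarrow> real" where
  "tw_S ls = (\<Sum>i < length ls. (ls ! i)\<^sup>2 / (1 + (ls ! i)\<^sup>2))"

text \<open>
  Orthonormal linear coordinates are given by the orthonormal basis \<open>xs\<close> or \<open>ys\<close> of coordinate
  vectors, the coordinate functions being the inner products with these.
\<close>

definition adapted_coordinates ::
    "(real ^ 'n::{finite,linorder} \<Rightarrow> real ^ 'm) \<Rightarrow>
     (real ^ 'n::_) list \<Rightarrow> (real ^ 'm) list \<Rightarrow> real list \<Rightarrow> bool" where
  "adapted_coordinates A xs ys ls \<longleftrightarrow>
     length xs = CARD('n) \<and> orthonormal_list xs \<and> same_orientation standard_basis xs \<and>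
     length ys = CARD('m) \<and> orthonormal_list ys \<and>
     length ls \<le> CARD('n) \<and> length ls \<le> CARD('m) \<and> (\<forall>l \<in> set ls. l > 0) \<and>
     (\<forall>i < CARD('n). A (xs ! i) = (if i < length ls then (ls ! i) *\<^sub>R (ys ! i) else 0))"

text \<open>As the numbering starts at \<open>0\<close>, the sign \<open>(-1)\<^bsup>i-1\<^esup>\<close> becomes \<open>(-1)\<^bsup>i\<^esup>\<close>.\<close>

definition tw_form_in_coordinates ::
    "(real ^ 'n) list \<Rightarrow> (real ^ 'm) list \<Rightarrow> real list \<Rightarrow> ((real ^ 'n) \<times> (real ^ 'm)) form" where
  "tw_form_in_coordinates xs ys ls vs =
     (let n = length xs;
          dx = (\<lambda>i w. inner (xs ! i) (fst w));
          dy = (\<lambda>i w. inner (ys ! i) (snd w))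
      in tw_C ls *
           ((1 - tw_S ls) * wedge (map dx [0..<n]) vs +
            (\<Sum>i < length ls. (-1) ^ i * ((ls ! i) / (1 + (ls ! i)\<^sup>2)) *
               wedge (dy i # map dx ([0..<i] @ [Suc i..<n])) vs)))"

text \<open>The form at \<open>p\<close>; it does not depend on the choice of adapted coordinates.\<close>

definition tsai_wang_form ::
    "(real ^ 'n::{finite,linorder} \<Rightarrow> real ^ 'm) \<Rightarrow> (real ^ 'n::_) \<times> (real ^ 'm) \<Rightarrow>
     ((real ^ 'n::_) \<times> (real ^ 'm)) form" where
  "tsai_wang_form F p =
     (case SOME (xs, ys, ls). adapted_coordinates (frechet_derivative F (at (fst p))) xs ys ls
      of (xs, ys, ls) \<Rightarrow> tw_form_in_coordinates xs ys ls)"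

end

theory Submission
  imports Defs
begin

text \<open>
  Write \<open>s\<^sub>i = \<lambda>\<^sub>i\<^sup>2 / (1 + \<lambda>\<^sub>i\<^sup>2)\<close> and \<open>g\<^sub>i = \<lambda>\<^sub>i / (1 + \<lambda>\<^sub>i\<^sup>2)\<close>. On an \<open>n\<close>-plane choose an orthonormal
  basis of vectors \<open>c\<^sub>k u\<^sub>k + d\<^sub>k v\<^sub>k\<close> with \<open>u\<^sub>k\<close> an orthonormal basis of the domain and \<open>v\<^sub>k\<close> orthogonal
  in the target (principal angles). Up to sign the value of the form there is
  \<open>C ((1 - S) \<Prod>c + \<Sum>\<^sub>k T\<^sub>k \<Sum>\<^sub>i g\<^sub>i \<langle>v\<^sub>k, y\<^sub>i\<rangle> \<langle>u\<^sub>k, x\<^sub>i\<rangle>)\<close> with \<open>T\<^sub>k = d\<^sub>k \<Prod>\<^bsub>j \<noteq> k\<^esub> c\<^sub>j\<close>, and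
  von Neumann's rearrangement bounds the double sum by \<open>Q = \<Sum>\<^sub>k T\<^sub>k g\<^bsub>p k\<^esub>\<close> for a permutation \<open>p\<close>. It
  remains to prove the scalar inequality
  \<open>((1 - S) \<Prod>c + Q)\<^sup>2 \<le> (1 - S) (\<Prod>c)\<^sup>2 + Q\<^sup>2 / S \<le> \<Prod> 1 / (1 + \<lambda>\<^sub>k\<^sup>2)\<close>, where the second
  step is an induction on the number of factors and uses \<open>S \<le> 1\<close>.

  In the case of equality \<open>d\<^sub>k = \<lambda>\<^bsub>p k\<^esub> c\<^sub>k\<close>. As \<open>S < 1\<close> makes \<open>g\<^sub>i\<close> strictly increasing in \<open>\<lambda>\<^sub>i\<close>, the
  rearrangement inequality also holds for the weights \<open>g\<^sub>i - \<epsilon> \<lambda>\<^sub>i\<close>; subtracting, the plane, a graph of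
  some \<open>B\<close>, satisfies \<open>\<langle>A, B\<rangle> \<ge> |A|\<^sup>2 = |B|\<^sup>2\<close>, so \<open>B = A\<close>.
\<close>

section \<open>Scalar inequalities\<close>

text \<open>
  With \<open>q = Q / S\<close> and \<open>d = l D\<close> the two sides of the induction step differ by
  \<open>s S ((c N - D q)\<^sup>2 + (1 / (S + s) - 1) (c q - D N)\<^sup>2)\<close>.
\<close>

lemma area_step:
  fixes l c d S N Q R :: real
  defines "s \<equiv> l\<^sup>2 / (1 + l\<^sup>2)"
    and "L \<equiv> (1 - (S + l\<^sup>2 / (1 + l\<^sup>2))) * (c * N)\<^sup>2
           + (c * Q + l / (1 + l\<^sup>2) * d * N)\<^sup>2 / (S + l\<^sup>2 / (1 + l\<^sup>2))"
  assumes cd: "c\<^sup>2 + d\<^sup>2 = 1" and S: "0 \<le> S" "S + s < 1" and Q: "S = 0 \<longrightarrow> Q = 0"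
    and R: "(1 - S) * N\<^sup>2 + Q\<^sup>2 / S \<le> R"
  shows "L \<le> R / (1 + l\<^sup>2)"
    and "L = R / (1 + l\<^sup>2) \<Longrightarrow> c * Q + l / (1 + l\<^sup>2) * d * N = (S + s) * (c * N) \<Longrightarrow> R > 0 \<Longrightarrow>
      (1 - S) * N\<^sup>2 + Q\<^sup>2 / S = R \<and> Q = S * N \<and> (N \<noteq> 0 \<longrightarrow> d = l * c)"
proof -
  have L: "L = (1 - (S + s)) * (c * N)\<^sup>2 + (c * Q + l / (1 + l\<^sup>2) * d * N)\<^sup>2 / (S + s)"
    by (simp add: L_def s_def)
  \<comment> \<open>Division by zero yields 0. For \<open>S = 0\<close> this gives
    \<open>q = 0\<close>, and \<open>Q = S * q\<close> survives because \<open>Q\<close> then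
    vanishes; likewise \<open>D = 0\<close> for \<open>l = 0\<close>, where \<open>s\<close>
    vanishes too.\<close>
  define q where "q = Q / S"
  define D where "D = (if l = 0 then 0 else d / l)"
  have l1: "1 + l\<^sup>2 > 0" by (simp add: add_pos_nonneg)
  have s0: "s \<ge> 0" "s < 1" and s1: "1 - s = 1 / (1 + l\<^sup>2)"
    using l1 by (auto simp: s_def field_simps)
  have Qq: "Q = S * q" using Q by (auto simp: q_def)
  have QS: "Q\<^sup>2 / S = S * q\<^sup>2" by (auto simp: q_def power2_eq_square)
  have sD: "l / (1 + l\<^sup>2) * d = s * D" 
    by (auto simp: s_def D_def power2_eq_square)
  define R0 where "R0 = (1 - S) * N\<^sup>2 + S * q\<^sup>2"
  have R0: "R0 \<le> R" using R QS by (simp add: R0_def)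
  have key: "L \<le> R0 / (1 + l\<^sup>2) \<and> (L = R / (1 + l\<^sup>2) \<longrightarrow> R0 = R) \<and>
    (L = R / (1 + l\<^sup>2) \<longrightarrow> s * S > 0 \<longrightarrow> c * N = D * q \<and> c * q = D * N)
    \<and> (L = R / (1 + l\<^sup>2) \<longrightarrow> s = 0 \<longrightarrow> R > 0 \<longrightarrow> c\<^sup>2 = 1)"
  proof (cases "s = 0")
    case True
    then have l0: "l = 0" using l1 by (simp add: s_def)
    have "L = c\<^sup>2 * R0" 
      using True l0 QS Qq
      by (cases "S = 0") (auto simp: L R0_def power_mult_distrib power2_eq_square algebra_simps)
    moreover have "c\<^sup>2 \<le> 1" using cd zero_le_power2[of d] by linarith
    then have "c\<^sup>2 * R0 \<le> R0"
      by (rule mult_left_le_one_le[rotated 2]) (use S s0 in \<open>auto simp: R0_def\<close>)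
    ultimately show ?thesis using l0 True R0 by auto
  next
    case False
    then have l0: "l \<noteq> 0" and sp: "s > 0" using s0 by (auto simp: s_def less_le)
    have dl: "d = l * D" using l0 by (simp add: D_def)
    have sl: "(1 - s) * l\<^sup>2 = s" using l1 by (simp add: s_def field_simps)
    have "1 / (1 + l\<^sup>2) = (1 - s) * c\<^sup>2 + (1 - s) * l\<^sup>2 * D\<^sup>2"
      using cd dl s1 by (metis (no_types, lifting) distrib_left mult.assoc mult.right_neutral power_mult_distrib)
    \<comment> \<open>With the constraint in this form, \<open>R0 / (1 + l\<^sup>2)\<close> is a
      product of two weighted sums of squares, with weights \<open>1 - s\<close>, \<open>s\<close>
      and \<open>1 - S\<close>, \<open>S\<close>; subtracting \<open>L\<close> leaves the squares in
      \<open>id\<close>.\<close>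
    then have e1: "1 / (1 + l\<^sup>2) = (1 - s) * c\<^sup>2 + s * D\<^sup>2" using sl by simp
    \<comment> \<open>With the reciprocal named \<open>t\<close>, the identities below are
      polynomial apart from \<open>(S + s) * t = 1\<close>.\<close>
    define t where "t = 1 / (S + s)"
    have t: "t > 1" "(S + s) * t = 1" using S sp by (auto simp: t_def)
    have sq: "(c * (S * q) + s * D * N)\<^sup>2 = (S + s) * (S * (c * q)\<^sup>2 + s * (D * N)\<^sup>2) - s * S * (c * q - D * N)\<^sup>2"
      by (simp add: power2_eq_square algebra_simps)
    have "(c * (S * q) + s * D * N)\<^sup>2 * t =
        ((S + s) * t) * (S * (c * q)\<^sup>2 + s * (D * N)\<^sup>2) - s * S * t * (c * q - D * N)\<^sup>2"
      unfolding sq by (simp add: algebra_simps)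
    then have Pt: "(c * (S * q) + s * D * N)\<^sup>2 * t = S * (c * q)\<^sup>2 + s * (D * N)\<^sup>2 - s * S * t * (c * q - D * N)\<^sup>2"
      by (simp only: t(2) mult_1)
    have id: "((1 - s) * c\<^sup>2 + s * D\<^sup>2) * ((1 - S) * N\<^sup>2 + S * q\<^sup>2)
      - ((1 - (S + s)) * (c * N)\<^sup>2 + (c * (S * q) + s * D * N)\<^sup>2 * t)
      = s * S * ((c * N - D * q)\<^sup>2 + (t - 1) * (c * q - D * N)\<^sup>2)"
      unfolding Pt by (simp add: power2_eq_square algebra_simps)
    have "L = (1 - (S + s)) * (c * N)\<^sup>2 + (c * (S * q) + s * D * N)\<^sup>2 * t"
      unfolding L sD Qq t_def by simp
    then have id2: "R0 / (1 + l\<^sup>2) - L = s * S * ((c * N - D * q)\<^sup>2 + (t - 1) * (c * q - D * N)\<^sup>2)"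
      using id by (simp add: R0_def flip: e1)
    have nn: "s * S * ((c * N - D * q)\<^sup>2 + (t - 1) * (c * q - D * N)\<^sup>2) \<ge> 0"
      using sp S t by (intro mult_nonneg_nonneg add_nonneg_nonneg) auto
    have R0': "R0 / (1 + l\<^sup>2) \<le> R / (1 + l\<^sup>2)" using R0 l1 by (simp add: divide_right_mono)
    show ?thesis
    proof (intro conjI impI)
      show "L \<le> R0 / (1 + l\<^sup>2)" using nn id2 by simp
      assume e: "L = R / (1 + l\<^sup>2)"
      then have "R0 / (1 + l\<^sup>2) = R / (1 + l\<^sup>2)" using nn id2 R0' by linarith
      then show "R0 = R" using l1 by (auto simp: divide_cancel_right)
      {
        assume "s * S > 0"
        moreover have "s * S * ((c * N - D * q)\<^sup>2 + (t - 1) * (c * q - D * N)\<^sup>2) = 0"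
          using e nn id2 R0' by linarith
        ultimately have "(c * N - D * q)\<^sup>2 + (t - 1) * (c * q - D * N)\<^sup>2 = 0" by auto
        moreover have "(t - 1) * (c * q - D * N)\<^sup>2 \<ge> 0" using t by simp
        ultimately have "(c * N - D * q)\<^sup>2 = 0" "(t - 1) * (c * q - D * N)\<^sup>2 = 0"
          using zero_le_power2[of "c * N - D * q"] by linarith+
        then show "c * N = D * q" "c * q = D * N" using t by auto
      }
    qed (use False in auto)
  qed
  have "R0 / (1 + l\<^sup>2) \<le> R / (1 + l\<^sup>2)" using R0 l1 by (simp add: divide_right_mono)
  then show "L \<le> R / (1 + l\<^sup>2)" using key by linarith
  \<comment> \<open>\<open>f\<close> is the relation \<open>Q = S * N\<close> for the product with
    one more factor. The conclusion returns it for the shorter product, so that equality can be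
    traced down by induction.\<close>
  assume e: "L = R / (1 + l\<^sup>2)" and f: "c * Q + l / (1 + l\<^sup>2) * d * N = (S + s) * (c * N)" and Rp: "R > 0"
  have RR: "R0 = R" using key e by blast
  have f': "c * (S * q) + s * D * N = (S + s) * (c * N)" using f unfolding sD Qq .
  have "Q = S * N \<and> (N \<noteq> 0 \<longrightarrow> d = l * c)"
  proof (cases "s = 0")
    case True
    then have l0: "l = 0" using l1 by (simp add: s_def)
    have "c\<^sup>2 = 1" using key e True Rp by blast
    then have "c \<noteq> 0" "d = 0" using cd by auto
    then show ?thesis using f l0 True by auto
  next
    case False
    then have l0: "l \<noteq> 0" and sp: "s > 0" using s0 by (auto simp: s_def less_le)
    have dl: "d = l * D" using l0 by (simp add: D_def)
    show ?thesis
    proof (cases "S = 0")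
      case True
      then show ?thesis using f' Q sp dl by auto
    next
      case False
      then have "s * S > 0" using sp S by simp
      then have a: "c * N = D * q" "c * q = D * N" using key e by auto
      have "(S + s) * (c * q) = (S + s) * (c * N)" using f' a(2) by (simp add: algebra_simps)
      then have b: "c * q = c * N" using sp S by simp
      have "D * N = c * N" using a(2) b by linarith
      moreover have "q = N"
      proof (cases "c = 0")
        case True
        then have "D \<noteq> 0" using cd dl by auto
        then show ?thesis using a True by simp
      qed (use b in simp)
      ultimately show ?thesis using Qq dl by auto
    qed
  qed
  then show "(1 - S) * N\<^sup>2 + Q\<^sup>2 / S = R \<and> Q = S * N \<and> (N \<noteq> 0 \<longrightarrow> d = l * c)"
    using RR QS by (simp add: R0_def)
qed

text \<open>The recursion \<open>QS\<close> makes adjoining one factor an instance of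
  \<open>area_step\<close>. The third conclusion shows that \<open>x / 0 = 0\<close> is harmless in
  the term with denominator \<open>S n\<close>.\<close>

lemma area_product:
  fixes l c d :: "nat \<Rightarrow> real"
  defines "S \<equiv> \<lambda>n. \<Sum>k<n. (l k)\<^sup>2 / (1 + (l k)\<^sup>2)"
    and "N \<equiv> \<lambda>n. \<Prod>k<n. c k"
    and "Q \<equiv> \<lambda>n. \<Sum>k<n. l k / (1 + (l k)\<^sup>2) * (d k * (\<Prod>j\<in>{..<n} - {k}. c j))"
    and "R \<equiv> \<lambda>n. \<Prod>k<n. 1 / (1 + (l k)\<^sup>2)"
  assumes cd: "\<And>k. k < n \<Longrightarrow> (c k)\<^sup>2 + (d k)\<^sup>2 = 1" and S: "S n < 1"
  shows "(1 - S n) * (N n)\<^sup>2 + (Q n)\<^sup>2 / S n \<le> R n"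
    and "(1 - S n) * (N n)\<^sup>2 + (Q n)\<^sup>2 / S n = R n \<Longrightarrow> Q n = S n * N n \<Longrightarrow> k < n \<Longrightarrow> d k = l k * c k"
    and "S n = 0 \<longrightarrow> Q n = 0"
proof -
  have QS: "Q (Suc m) = c m * Q m + l m / (1 + (l m)\<^sup>2) * d m * N m" for m
  proof -
    have "(\<Prod>j\<in>{..<Suc m} - {k}. c j) = c m * (\<Prod>j\<in>{..<m} - {k}. c j)" if "k < m" for k
    proof -
      have "{..<Suc m} - {k} = insert m ({..<m} - {k})" using that by auto
      then show ?thesis by simp
    qed
    then have "(\<Sum>k<m. l k / (1 + (l k)\<^sup>2) * (d k * (\<Prod>j\<in>{..<Suc m} - {k}. c j))) = c m * Q m"
      by (simp add: Q_def sum_distrib_left mult_ac)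
    moreover have "{..<Suc m} - {m} = {..<m}" by auto
    ultimately show ?thesis by (simp add: Q_def N_def)
  qed
  have S0: "0 \<le> S m" for m by (simp add: S_def sum_nonneg)
  have SQ: "S m = 0 \<longrightarrow> Q m = 0" for m
  proof
    assume "S m = 0"
    then have "\<forall>k<m. (l k)\<^sup>2 / (1 + (l k)\<^sup>2) = 0"
      unfolding S_def by (subst (asm) sum_nonneg_eq_0_iff) auto
    then have "\<forall>k<m. l k = 0" by (auto simp: add_nonneg_eq_0_iff)
    then show "Q m = 0" by (simp add: Q_def)
  qed
  then show "S n = 0 \<longrightarrow> Q n = 0" .
  have Rp: "R m > 0" for m
    unfolding R_def by (intro prod_pos) (auto simp: add_pos_nonneg)
  have ineq: "(1 - S m) * (N m)\<^sup>2 + (Q m)\<^sup>2 / S m \<le> R m"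
    if "\<And>k. k < m \<Longrightarrow> (c k)\<^sup>2 + (d k)\<^sup>2 = 1" "S m < 1" for m
    using that
  proof (induction m)
    case 0
    show ?case by (simp add: S_def N_def Q_def R_def)
  next
    case (Suc m)
    have S1: "S (Suc m) = S m + (l m)\<^sup>2 / (1 + (l m)\<^sup>2)" by (simp add: S_def)
    then have "S m < 1" using Suc.prems(2) by (smt (verit) zero_le_power2 divide_nonneg_nonneg)
    then have IH: "(1 - S m) * (N m)\<^sup>2 + (Q m)\<^sup>2 / S m \<le> R m" using Suc by simp
    have "R (Suc m) = R m / (1 + (l m)\<^sup>2)" "N (Suc m) = c m * N m" by (simp_all add: R_def N_def)
    then show ?case
      using area_step(1)[OF Suc.prems(1)[of m] S0 _ SQ IH] Suc.prems(2) S1 QS by simp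
  qed
  show "(1 - S n) * (N n)\<^sup>2 + (Q n)\<^sup>2 / S n \<le> R n" using ineq cd S by blast
  \<comment> \<open>Equality descends to the shorter products. The claim
    \<open>N m \<noteq> 0\<close> is carried along because \<open>area_step\<close> yields
    \<open>d m = l m * c m\<close> only where the product of the earlier factors is nonzero.\<close>
  have eq: "(\<forall>k<m. d k = l k * c k) \<and> N m \<noteq> 0"
    if "\<And>k. k < m \<Longrightarrow> (c k)\<^sup>2 + (d k)\<^sup>2 = 1" "S m < 1" 
     "(1 - S m) * (N m)\<^sup>2 + (Q m)\<^sup>2 / S m = R m" "Q m = S m * N m" for m
    using that
  proof (induction m)
    case 0
    show ?case by (simp add: N_def)
  next
    case (Suc m)
    have S1: "S (Suc m) = S m + (l m)\<^sup>2 / (1 + (l m)\<^sup>2)" by (simp add: S_def)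
    then have Sm: "S m < 1" using Suc.prems(2) by (smt (verit) zero_le_power2 divide_nonneg_nonneg)
    have IH: "(1 - S m) * (N m)\<^sup>2 + (Q m)\<^sup>2 / S m \<le> R m"
      using ineq[of m] Suc.prems Sm by simp
    have RN: "R (Suc m) = R m / (1 + (l m)\<^sup>2)" "N (Suc m) = c m * N m" by (simp_all add: R_def N_def)
    have "(1 - S m) * (N m)\<^sup>2 + (Q m)\<^sup>2 / S m = R m \<and> Q m = S m * N m \<and> (N m \<noteq> 0 \<longrightarrow> d m = l m * c m)"
      by (rule area_step(2)[OF Suc.prems(1)[of m] S0 _ SQ IH])
        (use Suc.prems(2-4) RN QS S1 Rp in simp_all)
    moreover from this have "(\<forall>k<m. d k = l k * c k) \<and> N m \<noteq> 0" using Suc Sm by auto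
    moreover from calculation have "c m \<noteq> 0" using Suc.prems(1)[of m] by auto
    ultimately show ?case using RN by (auto simp: less_Suc_eq)
  qed
  show "d k = l k * c k" if "(1 - S n) * (N n)\<^sup>2 + (Q n)\<^sup>2 / S n = R n" "Q n = S n * N n" "k < n"
    using eq[of n] cd S that by blast
qed

text \<open>Convexity of the square with weights \<open>1 - S\<close> and \<open>S\<close> reduces
  the claim to \<open>area_product\<close>; the defect is
  \<open>S * (1 - S) * (N - q)\<^sup>2\<close>. When it vanishes, \<open>Q = S * N\<close>, which is
  what the equality case of \<open>area_product\<close> asks for. The pairs
  \<open>(c k, d k)\<close> are points of circles, hence the torus.\<close>

lemma torus_bound:
  fixes l c d :: "nat \<Rightarrow> real" and n :: nat
  defines "S \<equiv> \<Sum>k<n. (l k)\<^sup>2 / (1 + (l k)\<^sup>2)"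
    and "N \<equiv> \<Prod>k<n. c k"
    and "Q \<equiv> \<Sum>k<n. l k / (1 + (l k)\<^sup>2) * (d k * (\<Prod>j\<in>{..<n} - {k}. c j))"
  assumes cd: "\<And>k. k < n \<Longrightarrow> (c k)\<^sup>2 + (d k)\<^sup>2 = 1" and S: "S < 1"
  shows "((1 - S) * N + Q)\<^sup>2 * (\<Prod>k<n. 1 + (l k)\<^sup>2) \<le> 1"
    and "((1 - S) * N + Q)\<^sup>2 * (\<Prod>k<n. 1 + (l k)\<^sup>2) = 1 \<Longrightarrow> k < n \<Longrightarrow> d k = l k * c k"
proof -
  define P where "P = (\<Prod>k<n. 1 + (l k)\<^sup>2)"
  have P0: "P > 0" unfolding P_def by (intro prod_pos) (auto simp: add_pos_nonneg)
  define q where "q = Q / S"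
  note main = area_product[where l = l and c = c and d = d and n = n, OF cd S[unfolded S_def],
      folded S_def N_def Q_def]
  have R: "(\<Prod>k<n. 1 / (1 + (l k)\<^sup>2)) = 1 / P" by (simp add: P_def prod_dividef)
  have S0: "0 \<le> S" by (simp add: S_def sum_nonneg)
  have Qq: "Q = S * q" and Q2: "(Q)\<^sup>2 / S = S * q\<^sup>2"
    using main(3) by (auto simp: q_def power2_eq_square)
  have id: "(1 - S) * (N)\<^sup>2 + S * q\<^sup>2 - ((1 - S) * N + S * q)\<^sup>2 = S * (1 - S) * (N - q)\<^sup>2"
    by (simp add: power2_eq_square algebra_simps)
  have nn: "S * (1 - S) * (N - q)\<^sup>2 \<ge> 0" using S0 S by simp
  have le: "(1 - S) * (N)\<^sup>2 + S * q\<^sup>2 \<le> 1 / P" using main(1) R Q2 by simp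
  have "((1 - S) * N + Q)\<^sup>2 \<le> 1 / P" using id nn le Qq by simp
  then show "((1 - S) * N + Q)\<^sup>2 * P \<le> 1" using P0 by (simp add: field_simps)
  assume "((1 - S) * N + Q)\<^sup>2 * P = 1" "k < n"
  then have e: "((1 - S) * N + Q)\<^sup>2 = 1 / P" using P0 by (simp add: field_simps)
  then have e': "((1 - S) * N + S * q)\<^sup>2 = 1 / P" using Qq by simp
  have "S * (1 - S) * (N - q)\<^sup>2 = 0" using id nn le e' by linarith
  then have "Q = S * N" using S Qq by auto
  moreover have "(1 - S) * (N)\<^sup>2 + (Q)\<^sup>2 / S = (\<Prod>k<n. 1 / (1 + (l k)\<^sup>2))"
    using e' id nn le Q2 R by linarith
  ultimately show "d k = l k * c k" using main(2) \<open>k < n\<close> by blast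
qed

section \<open>Rearrangement by Abel summation\<close>

text \<open>Abel summation: both sides are nonnegative combinations of the prefix sums.\<close>

lemma sum_mono_prefix:
  fixes f x y :: "nat \<Rightarrow> real"
  assumes "\<And>i j. i \<le> j \<Longrightarrow> j < n \<Longrightarrow> f j \<le> f i" "\<And>i. i < n \<Longrightarrow> 0 \<le> f i"
    and "\<And>k. k \<le> n \<Longrightarrow> sum x {..<k} \<le> sum y {..<k}"
  shows "(\<Sum>i<n. f i * x i) \<le> (\<Sum>i<n. f i * y i)"
proof (cases n)
  case (Suc m)
  \<comment> \<open>The slack term has to stay in the induction: passing to \<open>Suc k\<close>
    lowers its weight from \<open>f k\<close> to \<open>f (Suc k)\<close> on a nonnegative prefix
    difference.\<close>
  have "(\<Sum>i<Suc k. f i * x i) + f k * (sum y {..<Suc k} - sum x {..<Suc k}) \<le> (\<Sum>i<Suc k. f i * y i)"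
    if "k < n" for k
    using that
  proof (induction k)
    case (Suc k)
    have "f (Suc k) * (sum y {..<Suc k} - sum x {..<Suc k}) \<le> f k * (sum y {..<Suc k} - sum x {..<Suc k})"
      using assms(1)[of k "Suc k"] assms(3)[of "Suc k"] Suc.prems by (intro mult_right_mono) auto
    then show ?case using Suc.IH Suc.prems by (simp add: algebra_simps)
  qed (simp add: algebra_simps)
  from this[of m] Suc show ?thesis
    using assms(2)[of m] assms(3)[of n] by (smt (verit, best) lessI mult_nonneg_nonneg order_refl)
qed simp

lemma ex_antimono_enum:
  fixes f :: "nat \<Rightarrow> real"
  shows "\<exists>p. bij_betw p {..<n} {..<n} \<and> (\<forall>i j. i \<le> j \<longrightarrow> j < n \<longrightarrow> f (p j) \<le> f (p i))"
proof -
  define xs where "xs = sort_key (\<lambda>i. - f i) [0..<n]"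
  have d: "distinct xs" "set xs = {..<n}" "length xs = n" by (auto simp: xs_def)
  have "sorted (map (\<lambda>i. - f i) xs)" by (simp add: xs_def)
  then have "\<forall>i j. i \<le> j \<longrightarrow> j < n \<longrightarrow> f (xs ! j) \<le> f (xs ! i)"
    using d by (auto simp: sorted_iff_nth_mono)
  moreover have "bij_betw ((!) xs) {..<n} {..<n}" using d by (auto intro: bij_betw_nth)
  ultimately show ?thesis by blast
qed

text \<open>
  The permutation \<open>p\<close> depends only on the order of \<open>f\<close> and \<open>l\<close>, so that one \<open>p\<close> serves all weights
  \<open>g\<close> ordered like \<open>l\<close>.
\<close>

lemma trace_rearrangement:
  fixes M :: "nat \<Rightarrow> nat \<Rightarrow> real" and f l :: "nat \<Rightarrow> real"
  assumes row: "\<And>k J. k < n \<Longrightarrow> J \<subseteq> {..<n} \<Longrightarrow> (\<Sum>i\<in>J. \<bar>M k i\<bar>) \<le> 1"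
    and col: "\<And>i K. i < n \<Longrightarrow> K \<subseteq> {..<n} \<Longrightarrow> (\<Sum>k\<in>K. \<bar>M k i\<bar>) \<le> 1"
    and f: "\<And>k. k < n \<Longrightarrow> 0 \<le> f k"
  obtains p where "bij_betw p {..<n} {..<n}"
    "\<And>g. (\<And>i. i < n \<Longrightarrow> 0 \<le> g i) \<Longrightarrow> (\<And>i j. i < n \<Longrightarrow> j < n \<Longrightarrow> l i \<le> l j \<Longrightarrow> g i \<le> g j) \<Longrightarrow>
      (\<Sum>k<n. \<Sum>i<n. f k * g i * \<bar>M k i\<bar>) \<le> (\<Sum>k<n. f k * g (p k))"
proof -
  obtain a where a: "bij_betw a {..<n} {..<n}" "\<And>i j. i \<le> j \<Longrightarrow> j < n \<Longrightarrow> f (a j) \<le> f (a i)"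
    using ex_antimono_enum by metis
  obtain b where b: "bij_betw b {..<n} {..<n}" "\<And>i j. i \<le> j \<Longrightarrow> j < n \<Longrightarrow> l (b j) \<le> l (b i)"
    using ex_antimono_enum by metis
  have an: "a k < n" if "k < n" for k using a(1) that by (auto simp: bij_betw_def)
  have bn: "b k < n" if "k < n" for k using b(1) that by (auto simp: bij_betw_def)
  \<comment> \<open>\<open>p\<close> matches the k-th largest value of \<open>f\<close> with the
    k-th largest value of \<open>l\<close>; no weight \<open>g\<close> has been fixed yet.\<close>
  define p where "p = b \<circ> inv_into {..<n} a"
  show ?thesis
  proof
    show "bij_betw p {..<n} {..<n}" unfolding p_def
      using a(1) b(1) bij_betw_trans bij_betw_inv_into by blast
    fix g :: "nat \<Rightarrow> real" assume g: "\<And>i. i < n \<Longrightarrow> 0 \<le> g i" and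
      m: "\<And>i j. i < n \<Longrightarrow> j < n \<Longrightarrow> l i \<le> l j \<Longrightarrow> g i \<le> g j"
    define M' where "M' k i = \<bar>M (a k) (b i)\<bar>" for k i
    \<comment> \<open>A corner block of the sorted matrix sums to at most what the same block of the
      identity matrix does. This is all that enters the two Abel summations, first over columns and
      then over rows.\<close>
    have block: "(\<Sum>k<r. \<Sum>i<t. M' k i) \<le> min (real r) (real t)" if "r \<le> n" "t \<le> n" for r t
    proof -
      have inj: "inj_on a {..<r}" "inj_on b {..<t}" "a ` {..<r} \<subseteq> {..<n}" "b ` {..<t} \<subseteq> {..<n}"
        using a(1) b(1) that by (auto simp: bij_betw_def intro: inj_on_subset)
      have "(\<Sum>k<r. \<Sum>i<t. M' k i) \<le> (\<Sum>k<r. 1)"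
      proof (rule sum_mono)
        fix k assume "k \<in> {..<r}"
        then show "(\<Sum>i<t. M' k i) \<le> 1"
          using row[of "a k" "b ` {..<t}"] an that inj by (simp add: M'_def sum.reindex)
      qed
      moreover have "(\<Sum>i<t. \<Sum>k<r. M' k i) \<le> (\<Sum>i<t. 1)"
      proof (rule sum_mono)
        fix i assume "i \<in> {..<t}"
        then show "(\<Sum>k<r. M' k i) \<le> 1"
          using col[of "b i" "a ` {..<r}"] bn that inj by (simp add: M'_def sum.reindex)
      qed
      ultimately show ?thesis by (simp add: sum.swap[of _ "{..<r}"])
    qed
    have inner: "(\<Sum>k<r. \<Sum>i<n. g (b i) * M' k i) \<le> (\<Sum>k<r. g (b k))" if r: "r \<le> n" for r
    proof -
      have ind: "(\<Sum>i<t. if i < r then 1 else 0) = min (real r) (real t)" for t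
      proof -
        have "{..<t} \<inter> {i. i < r} = {..<min r t}" by auto
        then show ?thesis by (simp add: sum.If_cases)
      qed
      have "(\<Sum>k<r. \<Sum>i<n. g (b i) * M' k i) = (\<Sum>i<n. g (b i) * (\<Sum>k<r. M' k i))"
        by (simp add: sum.swap[of _ "{..<r}"] sum_distrib_left)
      also have "\<dots> \<le> (\<Sum>i<n. g (b i) * (if i < r then 1 else 0))"
      proof (rule sum_mono_prefix)
        fix t assume "t \<le> n"
        then show "(\<Sum>i<t. \<Sum>k<r. M' k i) \<le> (\<Sum>i<t. if i < r then 1 else 0)"
          unfolding ind using block[OF r] by (simp add: sum.swap[of _ "{..<r}"])
      qed (use g m b bn in auto)
      also have "\<dots> = (\<Sum>k<r. g (b k))"
      proof -
        have "{..<n} \<inter> {i. i < r} = {..<r}" using r by auto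
        then show ?thesis by (simp add: if_distrib[of "\<lambda>x. _ * x"] sum.If_cases cong: if_cong)
      qed
      finally show ?thesis .
    qed
    have "(\<Sum>k<n. \<Sum>i<n. f k * g i * \<bar>M k i\<bar>) = (\<Sum>k<n. f (a k) * (\<Sum>i<n. g i * \<bar>M (a k) i\<bar>))"
      using sum.reindex_bij_betw[OF a(1), of "\<lambda>k. \<Sum>i<n. f k * g i * \<bar>M k i\<bar>"]
      by (simp add: sum_distrib_left mult_ac)
    also have "\<dots> = (\<Sum>k<n. f (a k) * (\<Sum>i<n. g (b i) * M' k i))"
      unfolding M'_def
      by (intro sum.cong refl arg_cong2[where f = "(*)"] sum.reindex_bij_betw[OF b(1), symmetric])
    also have "\<dots> \<le> (\<Sum>k<n. f (a k) * g (b k))"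
      by (rule sum_mono_prefix) (use a inner f an in auto)
    also have "\<dots> = (\<Sum>k<n. f (a k) * g (p (a k)))"
      using a(1) by (intro sum.cong) (auto simp: p_def bij_betw_def)
    also have "\<dots> = (\<Sum>k<n. f k * g (p k))"
      using sum.reindex_bij_betw[OF a(1), of "\<lambda>k. f k * g (p k)"] by simp
    finally show "(\<Sum>k<n. \<Sum>i<n. f k * g i * \<bar>M k i\<bar>) \<le> (\<Sum>k<n. f k * g (p k))" .
  qed
qed

section \<open>Orthonormal lists\<close>

lemma orthonormal_list_inner:
  "orthonormal_list es \<Longrightarrow> i < length es \<Longrightarrow> j < length es \<Longrightarrow>
    inner (es ! i) (es ! j) = (if i = j then 1 else 0)"
  by (simp add: orthonormal_list_def)

lemma orthonormal_list_independent:
  assumes "orthonormal_list es"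
  shows "distinct es" "independent (set es)"
proof -
  show "distinct es"
    unfolding distinct_conv_nth using orthonormal_list_inner[OF assms] by (metis zero_neq_one)
  have "pairwise real_inner_class.orthogonal (set es)"
    using orthonormal_list_inner[OF assms]
    by (auto simp: pairwise_def real_inner_class.orthogonal_def in_set_conv_nth)
  moreover have "0 \<notin> set es"
    using orthonormal_list_inner[OF assms] by (auto simp: in_set_conv_nth) (metis inner_zero_left zero_neq_one)
  ultimately show "independent (set es)" by (rule pairwise_orthogonal_independent)
qed

lemma orthonormal_list_span:
  fixes es :: "'a::euclidean_space list"
  assumes "orthonormal_list es" "subspace P" "set es \<subseteq> P" "dim P = length es"
  shows "span (set es) = P"
proof
  have "card (set es) = dim P"
    using assms orthonormal_list_independent(1)[OF assms(1)] by (simp add: distinct_card)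
  then show "P \<subseteq> span (set es)"
    using card_ge_dim_independent[OF assms(3) orthonormal_list_independent(2)[OF assms(1)]] by simp
  show "span (set es) \<subseteq> P" using assms by (simp add: span_minimal)
qed

lemma orthonormal_list_expand:
  fixes es :: "'a::euclidean_space list"
  assumes "orthonormal_list es" "v \<in> span (set es)"
  shows "v = (\<Sum>k<length es. inner v (es ! k) *\<^sub>R es ! k)"
proof -
  define w where "w = v - (\<Sum>k<length es. inner v (es ! k) *\<^sub>R es ! k)"
  have "real_inner_class.orthogonal w (es ! j)" if "j < length es" for j
    using that orthonormal_list_inner[OF assms(1) _ that]
    by (simp add: w_def real_inner_class.orthogonal_def inner_diff_left inner_sum_left if_distrib[of "\<lambda>x. _ * x"]
        sum.If_cases cong: sum.cong_simp if_cong)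
  then have "real_inner_class.orthogonal w y" if "y \<in> set es" for y
    using that by (auto simp: in_set_conv_nth)
  then have "real_inner_class.orthogonal w x" if "x \<in> span (set es)" for x
    by (rule orthogonal_to_span[OF that])
  moreover have "w \<in> span (set es)"
    unfolding w_def by (intro span_diff span_sum span_mul assms span_base) auto
  ultimately have "w = 0" by (metis orthogonal_self)
  then show ?thesis by (simp add: w_def)
qed

lemma orthonormal_list_parseval:
  fixes es :: "'a::euclidean_space list"
  assumes "orthonormal_list es" "v \<in> span (set es)"
  shows "inner v w = (\<Sum>k<length es. inner v (es ! k) * inner w (es ! k))"
  by (subst orthonormal_list_expand[OF assms]) (simp add: inner_sum_left inner_commute[of w])

lemma bessel_inequality:
  fixes v :: "'i \<Rightarrow> 'a::real_inner"
  assumes "finite K" "\<And>i j. i \<in> K \<Longrightarrow> j \<in> K \<Longrightarrow> i \<noteq> j \<Longrightarrow> inner (v i) (v j) = 0"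
    and "\<And>i. i \<in> K \<Longrightarrow> inner (v i) (v i) \<le> 1"
  shows "(\<Sum>k\<in>K. (inner z (v k))\<^sup>2) \<le> inner z z"
proof -
  define p where "p = (\<Sum>k\<in>K. inner z (v k) *\<^sub>R v k)"
  have zp: "inner z p = (\<Sum>k\<in>K. (inner z (v k))\<^sup>2)"
    by (simp add: p_def inner_sum_right power2_eq_square)
  have pw: "inner p w = (\<Sum>k\<in>K. inner z (v k) * inner (v k) w)" for w
    by (simp add: p_def inner_sum_left)
  have "inner p p = (\<Sum>k\<in>K. inner z (v k) * (\<Sum>j\<in>K. inner z (v j) * inner (v k) (v j)))"
    unfolding pw by (simp add: p_def inner_sum_right)
  also have "\<dots> = (\<Sum>k\<in>K. inner z (v k) * (inner z (v k) * inner (v k) (v k)))"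
  proof (intro sum.cong refl arg_cong2[where f = "(*)"])
    fix k assume k: "k \<in> K"
    have "(\<Sum>j\<in>K. inner z (v j) * inner (v k) (v j)) = 
      (\<Sum>j\<in>K. if j = k then inner z (v k) * inner (v k) (v k) else 0)"
      by (rule sum.cong) (use assms(2) k in auto)
    then show "(\<Sum>j\<in>K. inner z (v j) * inner (v k) (v j)) = inner z (v k) * inner (v k) (v k)"
      using k assms(1) by simp
  qed
  also have "\<dots> \<le> (\<Sum>k\<in>K. (inner z (v k))\<^sup>2)"
  proof (rule sum_mono)
    fix k assume "k \<in> K"
    then have "(inner z (v k))\<^sup>2 * inner (v k) (v k) \<le> (inner z (v k))\<^sup>2 * 1"
      by (intro mult_left_mono assms) auto
    then show "inner z (v k) * (inner z (v k) * inner (v k) (v k)) \<le> (inner z (v k))\<^sup>2"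
      by (simp add: power2_eq_square mult.assoc)
  qed
  finally have pp: "inner p p \<le> (\<Sum>k\<in>K. (inner z (v k))\<^sup>2)" .
  have "0 \<le> inner (z - p) (z - p)" by simp
  then show ?thesis using zp pp by (simp add: inner_diff_left inner_diff_right inner_commute)
qed

text \<open>
  A unit vector of \<open>P\<close> on which \<open>|L|\<close> is maximal has image orthogonal to the image of its orthogonal
  complement in \<open>P\<close>; iterate.
\<close>

lemma ex_diagonalizing_frame:
  fixes L :: "'a::euclidean_space \<Rightarrow> 'b::euclidean_space"
  assumes "linear L" "subspace P"
  shows "\<exists>es. orthonormal_list es \<and> length es = dim P \<and> set es \<subseteq> P \<and>
    (\<forall>i<length es. \<forall>j<length es. i \<noteq> j \<longrightarrow> inner (L (es ! i)) (L (es ! j)) = 0) \<and>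
    (\<forall>i j. i \<le> j \<longrightarrow> j < length es \<longrightarrow> norm (L (es ! j)) \<le> norm (L (es ! i)))"
  using assms(2)
proof (induction "dim P" arbitrary: P)
  case 0
  then show ?case by (intro exI[of _ "[]"]) (auto simp: orthonormal_list_def)
next
  case (Suc n)
  interpret linear L by (rule assms)
  define K where "K = P \<inter> sphere 0 1"
  have "compact K" unfolding K_def using Suc.prems by (simp add: closed_subspace closed_Int_compact)
  moreover have "K \<noteq> {}"
  proof -
    have "P \<noteq> {0}" using Suc.hyps(2) by auto
    then obtain v where v: "v \<in> P" "v \<noteq> 0" using subspace_0[OF Suc.prems] by auto
    then have "v /\<^sub>R norm v \<in> K" using Suc.prems by (simp add: K_def subspace_mul)
    then show ?thesis by auto
  qed
  moreover have "continuous_on K (\<lambda>x. norm (L x))"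
    using assms(1) by (intro continuous_on_norm linear_continuous_on linear_conv_bounded_linear[THEN iffD1])
  ultimately obtain e where e: "e \<in> K" "\<And>x. x \<in> K \<Longrightarrow> norm (L x) \<le> norm (L e)"
    using continuous_attains_sup by metis
  have eP: "e \<in> P" "norm e = 1" using e by (auto simp: K_def)
  have max: "norm (L x) \<le> norm (L e) * norm x" if "x \<in> P" for x
  proof (cases "x = 0")
    case False
    have "x /\<^sub>R norm x \<in> K" using that Suc.prems False by (simp add: K_def subspace_mul)
    then have "norm (L (x /\<^sub>R norm x)) \<le> norm (L e)" using e(2) by blast
    then show ?thesis using False by (simp add: scaleR field_simps)
  qed simp
  define P' where "P' = {y \<in> P. real_inner_class.orthogonal e y}"
  have P': "subspace P'" unfolding P'_def
    using Suc.prems by (auto simp: subspace_def orthogonal_clauses)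
  have "dim {y \<in> P. \<forall>x\<in>span {e}. real_inner_class.orthogonal x y} + dim (span {e}) = dim P"
    by (rule dim_subspace_orthogonal_to_vectors) (use eP Suc.prems in \<open>auto simp: span_minimal\<close>)
  moreover have "{y \<in> P. \<forall>x\<in>span {e}. real_inner_class.orthogonal x y} = P'"
    by (auto simp: P'_def span_singleton real_inner_class.orthogonal_def intro: span_base)
  moreover have "dim (span {e}) = 1" using eP by auto
  ultimately have dP': "n = dim P'" using Suc.hyps(2) by simp
  from Suc.hyps(1)[OF dP' P'] obtain es where
    "orthonormal_list es \<and> length es = dim P' \<and> set es \<subseteq> P' \<and>
    (\<forall>i<length es. \<forall>j<length es. i \<noteq> j \<longrightarrow> inner (L (es ! i)) (L (es ! j)) = 0) \<and>
    (\<forall>i j. i \<le> j \<longrightarrow> j < length es \<longrightarrow> norm (L (es ! j)) \<le> norm (L (es ! i)))" ..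
  then have es: "orthonormal_list es" "length es = dim P'" "set es \<subseteq> P'"
    "\<And>i j. i < length es \<Longrightarrow> j < length es \<Longrightarrow> i \<noteq> j \<Longrightarrow> inner (L (es ! i)) (L (es ! j)) = 0"
    "\<And>i j. i \<le> j \<Longrightarrow> j < length es \<Longrightarrow> norm (L (es ! j)) \<le> norm (L (es ! i))"
    by simp_all
  have orth: "inner (L e) (L w) = 0" if w: "w \<in> P'" for w
  proof (rule ccontr)
    define a where "a = inner (L e) (L w)"
    assume "inner (L e) (L w) \<noteq> 0"
    then have a: "a \<noteq> 0" by (simp add: a_def)
    define b where "b = (norm (L e))\<^sup>2 * (norm w)\<^sup>2 - (norm (L w))\<^sup>2"
    \<comment> \<open>First variation at the maximizer: in the square of \<open>max\<close> at
      \<open>e + t *\<^sub>R w\<close> the constant terms cancel, and a term linear in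
      \<open>t\<close> faces a quadratic one.\<close>
    have ineq: "2 * t * a \<le> t\<^sup>2 * b" for t
    proof -
      have "norm (L (e + t *\<^sub>R w)) \<le> norm (L e) * norm (e + t *\<^sub>R w)"
        using w eP Suc.prems by (intro max) (auto simp: P'_def subspace_add subspace_mul)
      then have "(norm (L (e + t *\<^sub>R w)))\<^sup>2 \<le> (norm (L e))\<^sup>2 * (norm (e + t *\<^sub>R w))\<^sup>2"
        by (metis norm_ge_zero power_mono power_mult_distrib)
      moreover have "(norm (e + t *\<^sub>R w))\<^sup>2 = 1 + t\<^sup>2 * (norm w)\<^sup>2"
        using w eP by (subst norm_add_Pythagorean) (auto simp: P'_def orthogonal_clauses power_mult_distrib)
      moreover have "(norm (L (e + t *\<^sub>R w)))\<^sup>2 = (norm (L e))\<^sup>2 + 2 * t * a + t\<^sup>2 * (norm (L w))\<^sup>2"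
        by (simp only: add scaleR power2_norm_eq_inner) (simp add: inner_add_left inner_add_right a_def 
            inner_commute power2_eq_square algebra_simps)
      ultimately show ?thesis by (simp add: b_def algebra_simps)
    qed
    \<comment> \<open>For this \<open>t\<close> the quadratic term is at most \<open>t * a\<close>,
      half of the linear one. Adding 1 keeps the denominator positive.\<close>
    define t where "t = a / (\<bar>b\<bar> + 1)"
    have "t\<^sup>2 * b \<le> t\<^sup>2 * (\<bar>b\<bar> + 1)" by (intro mult_left_mono) auto
    also have "\<dots> = t * a" by (simp add: t_def power2_eq_square)
    finally have "t * a \<le> 0" using ineq[of t] by simp
    moreover have "t * a > 0" using a by (simp add: t_def flip: power2_eq_square)
    ultimately show False by simp
  qed
  have esP: "es ! i \<in> P'" if "i < length es" for i using es(3) that by auto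
  have unit: "norm (es ! i) = 1" if "i < length es" for i
    using orthonormal_list_inner[OF es(1) that that] by (simp add: norm_eq_sqrt_inner)
  show ?case
  proof (intro exI[of _ "e # es"] conjI allI impI)
    show "orthonormal_list (e # es)"
      unfolding orthonormal_list_def
    proof (intro allI impI)
      fix i j assume "i < length (e # es)" "j < length (e # es)"
      then show "inner ((e # es) ! i) ((e # es) ! j) = (if i = j then 1 else 0)"
        using orthonormal_list_inner[OF es(1)] esP eP
        by (cases i; cases j)
          (auto simp: P'_def real_inner_class.orthogonal_def inner_commute norm_eq_1)
    qed
    show "length (e # es) = dim P" using es(2) dP' Suc.hyps(2) by simp
    show "set (e # es) \<subseteq> P" using es(3) eP by (auto simp: P'_def)
    show "inner (L ((e # es) ! i)) (L ((e # es) ! j)) = 0"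
      if "i < length (e # es)" "j < length (e # es)" "i \<noteq> j" for i j
      using that es(4) esP orth by (cases i; cases j) (auto simp: inner_commute[of _ "L e"])
    show "norm (L ((e # es) ! j)) \<le> norm (L ((e # es) ! i))"
      if "i \<le> j" "j < length (e # es)" for i j
      using that es(5) esP max[of "es ! (j - 1)"] unit
      by (cases i; cases j) (auto simp: P'_def)
  qed
qed

lemma unit_scaled: "inner (v /\<^sub>R norm v) (v /\<^sub>R norm v) = 1" if "v \<noteq> 0" for v :: "'a::real_inner"
  using that by (simp only: norm_eq_1[symmetric]) simp

text \<open>Induction on the number of free indices: a unit vector orthogonal to the prescribed ones
  fills one of them. \<open>K\<close> is an arbitrary index set because the prescribed vectors need
  not occupy an initial segment.\<close>

lemma orthonormal_family_extend:
  fixes u :: "nat \<Rightarrow> 'a::euclidean_space"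
  assumes "K \<subseteq> {..<DIM('a)}" "\<And>i j. i \<in> K \<Longrightarrow> j \<in> K \<Longrightarrow> inner (u i) (u j) = (if i = j then 1 else 0)"
  shows "\<exists>w. (\<forall>k\<in>K. w k = u k) \<and>
    (\<forall>i<DIM('a). \<forall>j<DIM('a). inner (w i) (w j) = (if i = j then 1 else 0))"
  using assms
proof (induction "card ({..<DIM('a)} - K)" arbitrary: K u)
  case 0
  then have "K = {..<DIM('a)}" by auto
  with 0 show ?case by (intro exI[of _ u]) auto
next
  case (Suc m)
  then obtain k where k: "k < DIM('a)" "k \<notin> K"
    by (metis DiffD1 DiffD2 card_eq_0_iff all_not_in_conv lessThan_iff nat.distinct(1))
  have "finite K" using Suc.prems(1) finite_subset by blast
  have "K \<subset> {..<DIM('a)}" using k Suc.prems(1) by auto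
  then have "card K < DIM('a)" using psubset_card_mono[of "{..<DIM('a)}" K] by simp
  then have "dim (u ` K) < DIM('a)"
    using dim_le_card'[of "u ` K"] card_image_le[OF \<open>finite K\<close>, of u] \<open>finite K\<close> by simp
  then obtain x where x: "x \<noteq> 0" "\<And>y. y \<in> span (u ` K) \<Longrightarrow> real_inner_class.orthogonal x y"
    using orthogonal_to_subspace_exists by blast
  define z where "z = x /\<^sub>R norm x"
  have z: "inner z z = 1" "\<And>i. i \<in> K \<Longrightarrow> inner z (u i) = 0"
    using x unit_scaled by (auto simp: z_def real_inner_class.orthogonal_def span_base)
  have "\<exists>w. (\<forall>i\<in>insert k K. w i = (u(k := z)) i) \<and>
    (\<forall>i<DIM('a). \<forall>j<DIM('a). inner (w i) (w j) = (if i = j then 1 else 0))"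
  proof (rule Suc.hyps(1))
    have "{..<DIM('a)} - insert k K = ({..<DIM('a)} - K) - {k}" by auto
    then show "m = card ({..<DIM('a)} - insert k K)" using Suc.hyps(2) k by simp
    show "inner ((u(k := z)) i) ((u(k := z)) j) = (if i = j then 1 else 0)"
      if "i \<in> insert k K" "j \<in> insert k K" for i j
      using that k z Suc.prems(2) by (auto simp: inner_commute)
  qed (use k Suc.prems(1) in auto)
  then show ?case using k by (metis fun_upd_apply insertCI)
qed

text \<open>A vanishing \<open>p k\<close> puts no condition on \<open>us ! k\<close>, so it
  suffices to normalize the nonzero vectors and extend them, each kept at its own index.\<close>

lemma ex_orthonormal_directions:
  fixes p :: "nat \<Rightarrow> 'a::euclidean_space"
  assumes "\<And>i j. i < DIM('a) \<Longrightarrow> j < DIM('a) \<Longrightarrow> i \<noteq> j \<Longrightarrow> inner (p i) (p j) = 0"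
  obtains us where "orthonormal_list us" "length us = DIM('a)"
    "\<And>k. k < DIM('a) \<Longrightarrow> p k = norm (p k) *\<^sub>R us ! k"
proof -
  define K where "K = {k. k < DIM('a) \<and> p k \<noteq> 0}"
  have "\<exists>w. (\<forall>k\<in>K. w k = p k /\<^sub>R norm (p k)) \<and>
    (\<forall>i<DIM('a). \<forall>j<DIM('a). inner (w i) (w j) = (if i = j then 1 else 0))"
    using assms by (intro orthonormal_family_extend) (use unit_scaled in \<open>auto simp: K_def\<close>)
  then obtain w where w: "\<And>k. k \<in> K \<Longrightarrow> w k = p k /\<^sub>R norm (p k)"
    "\<And>i j. i < DIM('a) \<Longrightarrow> j < DIM('a) \<Longrightarrow> inner (w i) (w j) = (if i = j then 1 else 0)" by blast
  show ?thesis
  proof (rule that[of "map w [0..<DIM('a)]"])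
    show "orthonormal_list (map w [0..<DIM('a)])" using w(2) by (simp add: orthonormal_list_def)
    show "p k = norm (p k) *\<^sub>R map w [0..<DIM('a)] ! k" if "k < DIM('a)" for k
      using w(1)[of k] that by (cases "p k = 0") (auto simp: K_def)
  qed simp
qed

section \<open>Determinants and orientations\<close>

lemma mat_mult_entry:
  assumes "A \<in> carrier_mat n k" "B \<in> carrier_mat k m" "i < n" "j < m"
  shows "(A * B) $$ (i, j) = (\<Sum>l<k. A $$ (i, l) * B $$ (l, j))"
  using assms by (simp add: scalar_prod_def atLeast0LessThan)

lemma wedge_change_frame:
  fixes \<alpha>s :: "('a::real_vector \<Rightarrow> real) list"
  assumes M: "M \<in> carrier_mat n n" and n: "length \<alpha>s = n"
    and lin: "\<And>\<alpha>. \<alpha> \<in> set \<alpha>s \<Longrightarrow> linear \<alpha>"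
    and ws: "\<And>j. j < n \<Longrightarrow> ws ! j = (\<Sum>k<n. M $$ (j, k) *\<^sub>R vs ! k)"
  shows "wedge \<alpha>s ws = Determinant.det M * wedge \<alpha>s vs"
proof -
  let ?A = "mat n n (\<lambda>(i, j). (\<alpha>s ! i) (vs ! j))"
  have "mat n n (\<lambda>(i, j). (\<alpha>s ! i) (ws ! j)) = ?A * transpose_mat M"
  proof (rule eq_matI)
    fix i j assume "i < dim_row (?A * transpose_mat M)" "j < dim_col (?A * transpose_mat M)"
    then have ij: "i < n" "j < n" using M by auto
    then have "linear (\<alpha>s ! i)" using lin n by auto
    then show "mat n n (\<lambda>(i, j). (\<alpha>s ! i) (ws ! j)) $$ (i, j) = (?A * transpose_mat M) $$ (i, j)"
      using M ij by (subst mat_mult_entry[where n = n and k = n and m = n])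
        (auto simp: ws linear_sum linear_cmul mult.commute intro!: sum.cong)
  qed (use M in auto)
  then show ?thesis
    using M by (simp add: wedge_def n det_mult[where n = n] det_transpose mult.commute)
qed

text \<open>It serves in two ways: the rows are the coordinates of \<open>xs\<close> if
  \<open>us\<close> is an orthonormal basis, and the columns are the coordinates of
  \<open>us\<close> if \<open>xs\<close> is one.\<close>

definition frame_mat :: "'a::real_inner list \<Rightarrow> 'a list \<Rightarrow> real mat" where
  "frame_mat xs us = mat (length xs) (length us) (\<lambda>(i, j). inner (xs ! i) (us ! j))"

lemma frame_mat_orthogonal:
  fixes xs us :: "'a::euclidean_space list"
  assumes "orthonormal_list xs" "orthonormal_list us" "length xs = n" "length us = n"
    and "set xs \<subseteq> span (set us)"
  shows "frame_mat xs us * transpose_mat (frame_mat xs us) = 1\<^sub>m n"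
    and "\<bar>Determinant.det (frame_mat xs us)\<bar> = 1"
proof -
  let ?U = "frame_mat xs us"
  have U: "?U \<in> carrier_mat n n" using assms by (simp add: frame_mat_def)
  show id: "?U * transpose_mat ?U = 1\<^sub>m n"
  proof (rule eq_matI)
    fix i j assume "i < dim_row (1\<^sub>m n :: real mat)" "j < dim_col (1\<^sub>m n :: real mat)"
    then have ij: "i < n" "j < n" by auto
    then have "xs ! i \<in> span (set us)" using assms by auto
    then have "(\<Sum>k<n. inner (xs ! i) (us ! k) * inner (xs ! j) (us ! k)) = inner (xs ! i) (xs ! j)"
      using orthonormal_list_parseval[OF assms(2)] assms(4) by metis
    then show "(?U * transpose_mat ?U) $$ (i, j) = 1\<^sub>m n $$ (i, j)"
      using ij assms U by (subst mat_mult_entry[where n = n and k = n and m = n])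
        (auto simp: frame_mat_def orthonormal_list_inner)
  qed (use U in auto)
  have "Determinant.det ?U * Determinant.det ?U = 1"
    using arg_cong[OF id, of Determinant.det] U by (simp add: det_mult[where n = n] det_transpose)
  then show "\<bar>Determinant.det ?U\<bar> = 1" by (metis abs_mult_self_eq abs_1 abs_ge_zero abs_mult abs_square_eq_1 power2_eq_square)
qed

text \<open>The adjugate is the determinant times the inverse, and the inverse is the
  transpose.\<close>

lemma cofactor_orthogonal:
  fixes U :: "real mat"
  assumes U: "U \<in> carrier_mat n n" and o: "U * transpose_mat U = 1\<^sub>m n" and "i < n" "k < n"
  shows "cofactor U i k = Determinant.det U * U $$ (i, k)"
proof -
  have Ut: "transpose_mat U \<in> carrier_mat n n" using U by simp
  have aU: "adj_mat U \<in> carrier_mat n n" using adj_mat(1)[OF U] .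
  have "transpose_mat U * U = 1\<^sub>m n" using mat_mult_left_right_inverse[OF U Ut o] .
  then have "adj_mat U = (transpose_mat U * U) * adj_mat U" using aU by simp
  also have "\<dots> = transpose_mat U * (U * adj_mat U)" by (rule assoc_mult_mat[OF Ut U aU])
  also have "\<dots> = transpose_mat U * (Determinant.det U \<cdot>\<^sub>m 1\<^sub>m n)" using adj_mat(2)[OF U] by simp
  also have "\<dots> = Determinant.det U \<cdot>\<^sub>m transpose_mat U"
    using mult_smult_distrib[OF Ut one_carrier_mat] Ut by simp
  finally have "adj_mat U $$ (k, i) = (Determinant.det U \<cdot>\<^sub>m transpose_mat U) $$ (k, i)" by simp
  then show ?thesis using assms(3,4) U by (simp add: adj_mat_def)
qed

lemma det_scale_columns:
  fixes A :: "'a::comm_ring_1 mat"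
  assumes A: "A \<in> carrier_mat n n"
  shows "Determinant.det (mat n n (\<lambda>(i, j). A $$ (i, j) * c j)) = (\<Prod>j<n. c j) * Determinant.det A"
proof -
  have "(\<Prod>i = 0..<n. A $$ (i, p i) * c (p i)) = (\<Prod>j<n. c j) * (\<Prod>i = 0..<n. A $$ (i, p i))"
    if "p permutes {0..<n}" for p
    using prod.permute[OF that, of c] by (simp add: prod.distrib atLeast0LessThan mult.commute o_def)
  then show ?thesis
    using A by (subst (1 2) det_def'[of _ n]) (auto simp: sum_distrib_left mult_ac permutes_in_image 
        simp flip: atLeast0LessThan intro!: sum.cong prod.cong)
qed

text \<open>Deleting column \<open>k\<close> drops exactly the factor \<open>c k\<close>. Dividing
  the full product by \<open>c k\<close> would not do, since the cosines of principal angles may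
  vanish.\<close>

lemma cofactor_scale_columns:
  fixes A :: "'a::comm_ring_1 mat"
  assumes A: "A \<in> carrier_mat n n" and ik: "i < n" "k < n"
  shows "cofactor (mat n n (\<lambda>(i, j). A $$ (i, j) * c j)) i k = (\<Prod>j\<in>{..<n} - {k}. c j) * cofactor A i k"
proof -
  have "mat_delete (mat n n (\<lambda>(i, j). A $$ (i, j) * c j)) i k =
    mat (n - 1) (n - 1) (\<lambda>(a, b). mat_delete A i k $$ (a, b) * c (insert_index k b))"
    using A ik by (intro eq_matI) (auto simp: mat_delete_def insert_index_def)
  moreover have "(\<Prod>b<n - 1. c (insert_index k b)) = (\<Prod>j\<in>{..<n} - {k}. c j)"
  proof -
    have "insert_index k ` {0..<n - 1} = {0..<n} - {k}"
      using insert_index_image[of k "n - 1"] ik by simp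
    then show ?thesis
      using prod.reindex[OF insert_index_inj_on[of k "{..<n - 1}"], of c]
      by (simp add: atLeast0LessThan o_def)
  qed
  moreover have "mat_delete A i k \<in> carrier_mat (n - 1) (n - 1)"
    by (rule mat_delete_carrier[OF A])
  ultimately show ?thesis unfolding cofactor_def by (simp only: det_scale_columns) (simp add: mult_ac)
qed

section \<open>Orientation as an equivalence relation, and ordered bases\<close>

lemma same_orientation_trans:
  assumes "same_orientation bs cs" "same_orientation cs ds"
  shows "same_orientation bs ds"
proof -
  define n where "n = length bs"
  obtain M where M: "M \<in> carrier_mat n n" "Determinant.det M > 0"
    "\<And>i. i < n \<Longrightarrow> cs ! i = (\<Sum>j<n. M $$ (i, j) *\<^sub>R bs ! j)"
    using assms(1) by (auto simp: same_orientation_def n_def)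
  obtain K where K: "K \<in> carrier_mat n n" "Determinant.det K > 0"
    "\<And>i. i < n \<Longrightarrow> ds ! i = (\<Sum>j<n. K $$ (i, j) *\<^sub>R cs ! j)"
    using assms by (auto simp: same_orientation_def n_def)
  have "ds ! i = (\<Sum>j<n. (K * M) $$ (i, j) *\<^sub>R bs ! j)" if "i < n" for i
  proof -
    have "ds ! i = (\<Sum>j<n. \<Sum>k<n. (K $$ (i, j) * M $$ (j, k)) *\<^sub>R bs ! k)"
      using K(3)[OF that] M(3) by (simp add: scaleR_sum_right)
    also have "\<dots> = (\<Sum>k<n. \<Sum>j<n. (K $$ (i, j) * M $$ (j, k)) *\<^sub>R bs ! k)" by (rule sum.swap)
    also have "\<dots> = (\<Sum>k<n. (K * M) $$ (i, k) *\<^sub>R bs ! k)"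
      by (intro sum.cong refl) (simp add: mat_mult_entry[OF K(1) M(1) that] scaleR_sum_left)
    finally show ?thesis .
  qed
  moreover have "Determinant.det (K * M) > 0" "K * M \<in> carrier_mat n n"
    using M K by (auto simp: det_mult[where n = n])
  moreover have "length ds = n" using assms by (simp add: same_orientation_def n_def)
  ultimately show ?thesis unfolding same_orientation_def n_def by blast
qed

lemma same_orientation_sym:
  assumes "same_orientation bs cs"
  shows "same_orientation cs bs"
proof -
  define n where "n = length bs"
  obtain M where M: "M \<in> carrier_mat n n" "Determinant.det M > 0"
    "\<And>i. i < n \<Longrightarrow> cs ! i = (\<Sum>j<n. M $$ (i, j) *\<^sub>R bs ! j)"
    using assms(1) by (auto simp: same_orientation_def n_def)
  define K where "K = (1 / Determinant.det M) \<cdot>\<^sub>m adj_mat M"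
  have K: "K \<in> carrier_mat n n" using adj_mat(1)[OF M(1)] by (simp add: K_def)
  have KM: "K * M = 1\<^sub>m n"
    unfolding K_def using adj_mat[OF M(1)] M
    by (subst mult_smult_assoc_mat[where nr = n and n = n and nc = n]) (auto intro!: eq_matI)
  then have "Determinant.det K * Determinant.det M = 1"
    using det_mult[OF K M(1)] by simp
  then have "Determinant.det K > 0" using M(2) zero_less_mult_iff[of "Determinant.det K" "Determinant.det M"] by auto
  moreover have "bs ! i = (\<Sum>j<n. K $$ (i, j) *\<^sub>R cs ! j)" if "i < n" for i
  proof -
    have "(\<Sum>j<n. K $$ (i, j) *\<^sub>R cs ! j) = (\<Sum>j<n. \<Sum>k<n. (K $$ (i, j) * M $$ (j, k)) *\<^sub>R bs ! k)"
      using M(3) by (simp add: scaleR_sum_right)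
    also have "\<dots> = (\<Sum>k<n. \<Sum>j<n. (K $$ (i, j) * M $$ (j, k)) *\<^sub>R bs ! k)" by (rule sum.swap)
    also have "\<dots> = (\<Sum>k<n. (K * M) $$ (i, k) *\<^sub>R bs ! k)"
      by (intro sum.cong refl) (simp add: mat_mult_entry[OF K(1) M(1) that] scaleR_sum_left)
    also have "\<dots> = (\<Sum>k<n. if k = i then bs ! k else 0)"
      unfolding KM using that by (intro sum.cong) auto
    finally show ?thesis using that by simp
  qed
  moreover have "length cs = n" using assms by (simp add: same_orientation_def n_def)
  ultimately show ?thesis using K unfolding same_orientation_def n_def by auto
qed

lemma ordered_basis_length:
  fixes bs :: "'a::euclidean_space list"
  assumes "ordered_basis P bs"
  shows "length bs = dim P"
  using assms unfolding ordered_basis_def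
  by (metis dim_span_eq_card_independent distinct_card)

lemma ordered_basis_in: "ordered_basis P bs \<Longrightarrow> set bs \<subseteq> P"
  unfolding ordered_basis_def using span_superset by blast

lemma orthonormal_list_ordered_basis:
  fixes es :: "'a::euclidean_space list"
  assumes "orthonormal_list es" "subspace P" "set es \<subseteq> P" "length es = dim P"
  shows "ordered_basis P es"
  using assms orthonormal_list_span[OF assms(1-3)] orthonormal_list_independent[OF assms(1)]
  by (simp add: ordered_basis_def)

section \<open>The Tsai--Wang form on a split frame\<close>

text \<open>The increment of \<open>a / (1 + a\<^sup>2)\<close> is
  \<open>(b - a) * (1 - a * b) * K\<close>. The bound on \<open>S\<close> reads
  \<open>(1 - (a * b)\<^sup>2) * K \<ge> 1 - S\<close>; it forces \<open>a * b < 1\<close>, so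
  \<open>1 + a * b\<close> is at most 2 and the slope is at least \<open>(1 - S) / 2\<close>. This
  is the room for \<open>\<epsilon>\<close>.\<close>

lemma weight_mono:
  fixes a b S \<epsilon> :: real
  assumes ab: "0 \<le> a" "a \<le> b" and S: "a\<^sup>2 / (1 + a\<^sup>2) + b\<^sup>2 / (1 + b\<^sup>2) \<le> S" "S < 1"
    and \<epsilon>: "\<epsilon> \<le> (1 - S) / 2"
  shows "a / (1 + a\<^sup>2) - \<epsilon> * a \<le> b / (1 + b\<^sup>2) - \<epsilon> * b"
proof -
  define K where "K = 1 / ((1 + a\<^sup>2) * (1 + b\<^sup>2))"
  have p: "1 + a\<^sup>2 > 0" "1 + b\<^sup>2 > 0" by (simp_all add: add_pos_nonneg)
  then have K: "K > 0" by (simp add: K_def)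
  have KK: "K * ((1 + a\<^sup>2) * (1 + b\<^sup>2)) = 1" using p by (simp add: K_def)
  have r: "x / (1 + a\<^sup>2) = x * K * (1 + b\<^sup>2)" "x / (1 + b\<^sup>2) = x * K * (1 + a\<^sup>2)" for x
    using p by (simp_all add: K_def)
  have "(1 - (a * b)\<^sup>2) * K \<ge> 1 - S"
    using S(1) KK unfolding r by (simp add: algebra_simps power2_eq_square)
  then have w: "(1 + a * b) * ((1 - a * b) * K) \<ge> 1 - S" by (simp add: power2_eq_square algebra_simps)
  have ab0: "a * b \<ge> 0" using ab by simp
  have pos: "(1 - a * b) * K > 0"
  proof (rule ccontr)
    assume "\<not> (1 - a * b) * K > 0"
    then have "(1 + a * b) * ((1 - a * b) * K) \<le> 0" using ab0 by (rule_tac mult_nonneg_nonpos) linarith+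
    then show False using w S by simp
  qed
  then have "a * b < 1" using K by (simp add: zero_less_mult_iff)
  then have "(1 + a * b) * ((1 - a * b) * K) \<le> 2 * ((1 - a * b) * K)" using pos by (intro mult_right_mono) auto
  then have "\<epsilon> \<le> (1 - a * b) * K" using w \<epsilon> by simp
  then have "0 \<le> (b - a) * ((1 - a * b) * K - \<epsilon>)" using ab by simp
  then show ?thesis unfolding r by (simp add: algebra_simps power2_eq_square)
qed

text \<open>Together with Bessel's inequality this bounds the row and column sums of the matrix
  \<open>M\<close> in \<open>\<Theta>_split_frame\<close>.\<close>

lemma abs_prod_sum_le_1:
  fixes a b :: "nat \<Rightarrow> real"
  assumes "(\<Sum>i\<in>J. (a i)\<^sup>2) \<le> 1" "(\<Sum>i\<in>J. (b i)\<^sup>2) \<le> 1"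
  shows "(\<Sum>i\<in>J. \<bar>a i * b i\<bar>) \<le> 1"
proof -
  have "\<bar>x * y\<bar> \<le> (x\<^sup>2 + y\<^sup>2) / 2" for x y :: real
    using sum_squares_bound[of "\<bar>x\<bar>" "\<bar>y\<bar>"] by (simp add: abs_mult)
  then have "(\<Sum>i\<in>J. \<bar>a i * b i\<bar>) \<le> (\<Sum>i\<in>J. ((a i)\<^sup>2 + (b i)\<^sup>2) / 2)" by (rule sum_mono)
  also have "\<dots> \<le> 1" using assms by (simp add: sum.distrib flip: sum_divide_distrib)
  finally show ?thesis .
qed

locale tw_coordinates =
  fixes A :: "real ^ 'n::{finite,linorder} \<Rightarrow> real ^ 'm" and xs :: "(real ^ 'n::_) list"
    and ys :: "(real ^ 'm) list" and ls :: "real list"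
  assumes lin: "linear A" and adapted: "adapted_coordinates A xs ys ls"
begin

text \<open>Padding by zeros beyond the rank lets every sum run over all \<open>CARD('n)\<close>
  indices, also when the target has smaller dimension than the domain.\<close>

definition "lam i = (if i < length ls then ls ! i else 0)"
definition "yv i = (if i < length ls then ys ! i else 0)"
definition "\<Theta> = tw_form_in_coordinates xs ys ls"
text \<open>Column \<open>k\<close> holds the coordinates of \<open>fst (vs ! k)\<close> in the
  basis \<open>xs\<close>; the determinant is the value of the horizontal volume form.\<close>

definition "xmat vs = frame_mat xs (map fst (vs :: ((real ^ 'n::_) \<times> (real ^ 'm)) list))"

lemma xs: "orthonormal_list xs" "length xs = CARD('n)" "span (set xs) = UNIV"
  and ys: "orthonormal_list ys" "length ys = CARD('m)"
  and ls: "length ls \<le> CARD('n)" "length ls \<le> CARD('m)"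
  and orient: "same_orientation standard_basis xs"
  using adapted orthonormal_list_span[of xs UNIV] by (auto simp: adapted_coordinates_def)

lemma lam_nonneg: "0 \<le> lam i"
  using adapted by (auto simp: adapted_coordinates_def lam_def dest!: nth_mem intro: less_imp_le)

lemma A_xs: "i < CARD('n) \<Longrightarrow> A (xs ! i) = lam i *\<^sub>R yv i"
  using adapted by (auto simp: adapted_coordinates_def lam_def yv_def)

lemma yv_inner: "inner (yv i) (yv j) = (if i = j \<and> i < length ls then 1 else 0)"
  using ys ls by (auto simp: yv_def orthonormal_list_inner)

lemma A_expand: "A v = (\<Sum>i<CARD('n). (inner v (xs ! i) * lam i) *\<^sub>R yv i)"
proof -
  have "A v = A (\<Sum>i<CARD('n). inner v (xs ! i) *\<^sub>R xs ! i)"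
    using orthonormal_list_expand[OF xs(1), of v] xs by simp
  also have "\<dots> = (\<Sum>i<CARD('n). (inner v (xs ! i) * lam i) *\<^sub>R yv i)"
    using lin by (simp add: linear_sum linear_cmul A_xs)
  finally show ?thesis .
qed

lemma inner_yv_A: "i < CARD('n) \<Longrightarrow> inner (yv i) (A v) = lam i * inner (xs ! i) v"
  unfolding A_expand inner_sum_right inner_scaleR_right yv_inner
  by (auto simp: if_distrib[of "\<lambda>x. _ * x"] sum.If_cases lam_def inner_commute cong: if_cong)

lemma norm_A: "(norm (A v))\<^sup>2 = (\<Sum>i<CARD('n). (lam i)\<^sup>2 * (inner v (xs ! i))\<^sup>2)"
proof -
  have "(norm (A v))\<^sup>2 = (\<Sum>i<CARD('n). inner v (xs ! i) * lam i * inner (yv i) (A v))"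
    unfolding power2_norm_eq_inner by (subst A_expand) (simp add: inner_sum_left)
  also have "\<dots> = (\<Sum>i<CARD('n). (lam i)\<^sup>2 * (inner v (xs ! i))\<^sup>2)"
    by (intro sum.cong refl) (simp add: inner_yv_A power2_eq_square inner_commute[of v])
  finally show ?thesis .
qed

lemma sum_lam: "f 0 = 0 \<Longrightarrow> (\<Sum>i<CARD('n). f (lam i)) = (\<Sum>i<length ls. f (ls ! i))"
  for f :: "real \<Rightarrow> real"
proof -
  assume f: "f 0 = 0"
  have "(\<Sum>i<length ls. f (ls ! i)) = (\<Sum>i<length ls. f (lam i))" by (simp add: lam_def)
  also have "\<dots> = (\<Sum>i<CARD('n). f (lam i))"
    by (rule sum.mono_neutral_left) (use ls f in \<open>auto simp: lam_def\<close>)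
  finally show ?thesis by simp
qed

lemma tw_S_lam: "tw_S ls = (\<Sum>i<CARD('n). (lam i)\<^sup>2 / (1 + (lam i)\<^sup>2))"
  using sum_lam[of "\<lambda>x. x\<^sup>2 / (1 + x\<^sup>2)"] by (simp add: tw_S_def)

lemma tw_C_lam: "(tw_C ls)\<^sup>2 = (\<Prod>i<CARD('n). 1 + (lam i)\<^sup>2)" "0 < tw_C ls"
proof -
  have p: "0 < (\<Prod>i<length ls. 1 + (ls ! i)\<^sup>2)" by (intro prod_pos) (auto simp: add_pos_nonneg)
  then show "0 < tw_C ls" by (simp add: tw_C_def)
  have "(\<Prod>i<length ls. 1 + (ls ! i)\<^sup>2) = (\<Prod>i<length ls. 1 + (lam i)\<^sup>2)" by (simp add: lam_def)
  also have "\<dots> = (\<Prod>i<CARD('n). 1 + (lam i)\<^sup>2)"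
    by (rule prod.mono_neutral_left) (use ls in \<open>auto simp: lam_def\<close>)
  finally show "(tw_C ls)\<^sup>2 = (\<Prod>i<CARD('n). 1 + (lam i)\<^sup>2)" using p by (simp add: tw_C_def)
qed

text \<open>Laplace expansion along the row of \<open>\<alpha>\<close>: deleting that row leaves the
  same minors as deleting row \<open>i\<close> of \<open>xmat vs\<close>, and
  \<open>(-1) ^ i\<close> accounts for moving the row from position \<open>i\<close> to the
  front.\<close>

lemma wedge_replaced:
  assumes vs: "length vs = CARD('n)" and i: "i < CARD('n)"
  shows "(-1) ^ i * wedge (\<alpha> # map (\<lambda>i w. inner (xs ! i) (fst w)) ([0..<i] @ [Suc i..<CARD('n)])) vs
    = (\<Sum>k<CARD('n). \<alpha> (vs ! k) * cofactor (xmat vs) i k)"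
proof -
  define \<beta>s where "\<beta>s = \<alpha> # map (\<lambda>i w. inner (xs ! i) (fst (w :: (real ^ 'n::_) \<times> (real ^ 'm)))) ([0..<i] @ [Suc i..<CARD('n)])"
  have l: "length \<beta>s = CARD('n)" using i by (simp add: \<beta>s_def)
  define B where "B = mat (CARD('n)) (CARD('n)) (\<lambda>(a, b). (\<beta>s ! a) (vs ! b))"
  have B: "B \<in> carrier_mat (CARD('n)) (CARD('n))" by (simp add: B_def)
  have del: "mat_delete B 0 k = mat_delete (xmat vs) i k" if "k < CARD('n)" for k
  proof (rule eq_matI)
    fix a b assume "a < dim_row (mat_delete (xmat vs) i k)" "b < dim_col (mat_delete (xmat vs) i k)"
    then have ab: "a < CARD('n) - 1" "b < CARD('n) - 1" using vs xs by (auto simp: xmat_def frame_mat_def)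
    have "\<beta>s ! Suc a = (\<lambda>w. inner (xs ! (if a < i then a else Suc a)) (fst w))"
      using ab i by (auto simp: \<beta>s_def nth_append)
    then show "mat_delete B 0 k $$ (a, b) = mat_delete (xmat vs) i k $$ (a, b)"
      using ab vs xs that i by (auto simp: mat_delete_def B_def xmat_def frame_mat_def)
  qed (use vs xs in \<open>auto simp: B_def xmat_def frame_mat_def\<close>)
  have "wedge \<beta>s vs = (\<Sum>k<CARD('n). B $$ (0, k) * cofactor B 0 k)"
    unfolding wedge_def l B_def[symmetric] by (rule laplace_expansion_row[OF B]) simp
  also have "\<dots> = (\<Sum>k<CARD('n). \<alpha> (vs ! k) * ((-1) ^ k * Determinant.det (mat_delete (xmat vs) i k)))"
    by (intro sum.cong refl) (simp add: cofactor_def del, simp add: B_def \<beta>s_def)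
  finally show ?thesis
    by (simp add: \<beta>s_def cofactor_def power_add sum_distrib_left mult_ac)
qed

lemma \<Theta>_eq:
  assumes vs: "length vs = CARD('n)"
  shows "\<Theta> vs = tw_C ls * ((1 - tw_S ls) * Determinant.det (xmat vs) +
    (\<Sum>i<CARD('n). lam i / (1 + (lam i)\<^sup>2) * (\<Sum>k<CARD('n). inner (yv i) (snd (vs ! k)) * cofactor (xmat vs) i k)))"
proof -
  have 1: "wedge (map (\<lambda>i w. inner (xs ! i) (fst w)) [0..<CARD('n)]) vs = Determinant.det (xmat vs)"
    unfolding wedge_def using vs xs
    by (auto simp: xmat_def frame_mat_def intro!: arg_cong[of _ _ Determinant.det] eq_matI)
  have "(\<Sum>i<length ls. (-1) ^ i * ((ls ! i) / (1 + (ls ! i)\<^sup>2)) *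
      wedge ((\<lambda>w. inner (ys ! i) (snd w)) # map (\<lambda>i w. inner (xs ! i) (fst w)) ([0..<i] @ [Suc i..<CARD('n)])) vs)
    = (\<Sum>i<length ls. lam i / (1 + (lam i)\<^sup>2) * (\<Sum>k<CARD('n). inner (yv i) (snd (vs ! k)) * cofactor (xmat vs) i k))"
  proof (rule sum.cong[OF refl])
    fix i assume i: "i \<in> {..<length ls}"
    then have "i < CARD('n)" using ls by auto
    note wedge_replaced[OF vs this, of "\<lambda>w. inner (ys ! i) (snd w)", symmetric]
    then show "(-1) ^ i * ((ls ! i) / (1 + (ls ! i)\<^sup>2)) *
      wedge ((\<lambda>w. inner (ys ! i) (snd w)) # map (\<lambda>i w. inner (xs ! i) (fst w)) ([0..<i] @ [Suc i..<CARD('n)])) vs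
      = lam i / (1 + (lam i)\<^sup>2) * (\<Sum>k<CARD('n). inner (yv i) (snd (vs ! k)) * cofactor (xmat vs) i k)"
      using i by (simp add: lam_def yv_def)
  qed
  also have "\<dots> = (\<Sum>i<CARD('n). lam i / (1 + (lam i)\<^sup>2) * (\<Sum>k<CARD('n). inner (yv i) (snd (vs ! k)) * cofactor (xmat vs) i k))"
    by (rule sum.mono_neutral_left) (use ls in \<open>auto simp: lam_def\<close>)
  finally show ?thesis
    unfolding \<Theta>_def tw_form_in_coordinates_def Let_def xs(2) 1 by simp
qed

lemma \<Theta>_change_frame:
  assumes "M \<in> carrier_mat (CARD('n)) (CARD('n))"
    and "\<And>j. j < CARD('n) \<Longrightarrow> ws ! j = (\<Sum>k<CARD('n). M $$ (j, k) *\<^sub>R vs ! k)"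
  shows "\<Theta> ws = Determinant.det M * \<Theta> vs"
proof -
  have l1: "linear (\<lambda>w :: (real ^ 'n::_) \<times> (real ^ 'm). inner v (fst w))" for v
    by (rule linearI) (simp_all add: inner_add_right)
  have l2: "linear (\<lambda>w :: (real ^ 'n::_) \<times> (real ^ 'm). inner v (snd w))" for v
    by (rule linearI) (simp_all add: inner_add_right)
  have 1: "wedge (map (\<lambda>i w. inner (xs ! i) (fst w)) [0..<CARD('n)]) ws
    = Determinant.det M * wedge (map (\<lambda>i w. inner (xs ! i) (fst w)) [0..<CARD('n)]) vs"
    by (rule wedge_change_frame) (use assms l1 in auto)
  have 2: "wedge ((\<lambda>w. inner (ys ! i) (snd w)) # map (\<lambda>i w. inner (xs ! i) (fst w)) ([0..<i] @ [Suc i..<CARD('n)])) ws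
    = Determinant.det M * wedge ((\<lambda>w. inner (ys ! i) (snd w)) # map (\<lambda>i w. inner (xs ! i) (fst w)) ([0..<i] @ [Suc i..<CARD('n)])) vs"
    if "i < length ls" for i
    by (rule wedge_change_frame) (use assms l1 l2 that ls in auto)
  have "(\<Sum>i<length ls. (-1) ^ i * ((ls ! i) / (1 + (ls ! i)\<^sup>2)) *
      wedge ((\<lambda>w. inner (ys ! i) (snd w)) # map (\<lambda>i w. inner (xs ! i) (fst w)) ([0..<i] @ [Suc i..<CARD('n)])) ws)
    = Determinant.det M * (\<Sum>i<length ls. (-1) ^ i * ((ls ! i) / (1 + (ls ! i)\<^sup>2)) *
      wedge ((\<lambda>w. inner (ys ! i) (snd w)) # map (\<lambda>i w. inner (xs ! i) (fst w)) ([0..<i] @ [Suc i..<CARD('n)])) vs)"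
    unfolding sum_distrib_left
    by (intro sum.cong refl, subst 2) (simp_all only: lessThan_iff mult_ac)
  then show ?thesis
    unfolding \<Theta>_def tw_form_in_coordinates_def Let_def xs(2) 1 by (simp add: algebra_simps)
qed

text \<open>On the graph the vertical coordinates are \<open>lam i\<close> times the horizontal
  ones, so each cofactor sum is a Laplace expansion of the full determinant. The resulting
  coefficients add up to \<open>tw_S ls\<close> and cancel the subtracted one.\<close>

lemma \<Theta>_graph:
  assumes vs: "length vs = CARD('n)" and g: "\<And>k. k < CARD('n) \<Longrightarrow> snd (vs ! k) = A (fst (vs ! k))"
  shows "\<Theta> vs = tw_C ls * Determinant.det (xmat vs)"
proof -
  have X: "xmat vs \<in> carrier_mat (CARD('n)) (CARD('n))" using vs xs by (simp add: xmat_def frame_mat_def)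
  have "(\<Sum>k<CARD('n). inner (yv i) (snd (vs ! k)) * cofactor (xmat vs) i k) = lam i * Determinant.det (xmat vs)"
    if i: "i < CARD('n)" for i
  proof -
    have "(\<Sum>k<CARD('n). inner (yv i) (snd (vs ! k)) * cofactor (xmat vs) i k)
      = (\<Sum>k<CARD('n). lam i * (xmat vs $$ (i, k) * cofactor (xmat vs) i k))"
      by (intro sum.cong refl) (use i vs xs in \<open>simp add: g inner_yv_A xmat_def frame_mat_def\<close>)
    then show ?thesis using laplace_expansion_row[OF X i] by (simp add: sum_distrib_left)
  qed
  then have "(\<Sum>i<CARD('n). lam i / (1 + (lam i)\<^sup>2) * (\<Sum>k<CARD('n). inner (yv i) (snd (vs ! k)) * cofactor (xmat vs) i k))
    = (\<Sum>i<CARD('n). (lam i)\<^sup>2 / (1 + (lam i)\<^sup>2) * Determinant.det (xmat vs))"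
    by (intro sum.cong refl) (simp add: power2_eq_square)
  also have "\<dots> = tw_S ls * Determinant.det (xmat vs)" by (simp add: tw_S_lam sum_distrib_right)
  finally show ?thesis unfolding \<Theta>_eq[OF vs] by (simp add: algebra_simps)
qed

text \<open>Split frames are enough: every plane has one by \<open>ex_split_frame\<close>, and
  orthonormal frames of the same plane give values that differ at most in sign.\<close>

lemma \<Theta>_split_frame:
  fixes e :: "((real ^ 'n::_) \<times> (real ^ 'm)) list"
  assumes S_less: "tw_S ls < 1"
    and e: "orthonormal_list e" "length e = CARD('n)"
    and split: "\<And>i j. i < CARD('n) \<Longrightarrow> j < CARD('n) \<Longrightarrow> i \<noteq> j \<Longrightarrow> inner (snd (e ! i)) (snd (e ! j)) = 0"
  shows "\<bar>\<Theta> e\<bar> \<le> 1"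
    and "\<bar>\<Theta> e\<bar> = 1 \<Longrightarrow> k < CARD('n) \<Longrightarrow> snd (e ! k) = A (fst (e ! k))"
proof -
  let ?n = "CARD('n)"
  define S where "S = tw_S ls"
  define g where "g i = lam i / (1 + (lam i)\<^sup>2)" for i
  define c where "c k = norm (fst (e ! k))" for k
  define d where "d k = norm (snd (e ! k))" for k
  \<comment> \<open>\<open>sgn\<close> of a zero vector is zero, so \<open>v k\<close> is a unit
    vector or zero; this is why \<open>v1\<close> is only an inequality.\<close>
  define v where "v k = sgn (snd (e ! k))" for k
  have dv: "snd (e ! k) = d k *\<^sub>R v k" for k
    by (cases "snd (e ! k) = 0") (auto simp: d_def v_def sgn_div_norm)
  have ee: "inner (fst (e ! i)) (fst (e ! j)) + inner (snd (e ! i)) (snd (e ! j)) = (if i = j then 1 else 0)"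
    if "i < ?n" "j < ?n" for i j
    using orthonormal_list_inner[OF e(1)] that e(2) by (simp add: inner_prod_def)
  have cd: "(c k)\<^sup>2 + (d k)\<^sup>2 = 1" if "k < ?n" for k
    using ee[OF that that] by (simp add: c_def d_def power2_norm_eq_inner)
  \<comment> \<open>The frame is orthonormal, so orthogonality of the vertical parts passes to the
    horizontal parts.\<close>
  have "inner (fst (e ! i)) (fst (e ! j)) = 0" if "i < ?n" "j < ?n" "i \<noteq> j" for i j
    using ee[of i j] split[of i j] that by simp
  then obtain us where us: "orthonormal_list us" "length us = ?n"
    and cu: "\<And>k. k < ?n \<Longrightarrow> fst (e ! k) = c k *\<^sub>R us ! k"
    by (rule_tac ex_orthonormal_directions[of "\<lambda>k. fst (e ! k)"]) (simp_all add: c_def)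
  have uspan: "span (set us) = UNIV" using orthonormal_list_span[OF us(1), of UNIV] us(2) by simp
  define U where "U = frame_mat xs us"
  have U: "U \<in> carrier_mat ?n ?n" using xs us by (simp add: U_def frame_mat_def)
  have UU: "U * transpose_mat U = 1\<^sub>m ?n" and dU: "\<bar>Determinant.det U\<bar> = 1"
    using frame_mat_orthogonal[OF xs(1) us(1) xs(2) us(2)] uspan by (auto simp: U_def)
  define N where "N = (\<Prod>k<?n. c k)"
  define T where "T k = d k * (\<Prod>j\<in>{..<?n} - {k}. c j)" for k
  define M where "M k i = inner (v k) (yv i) * inner (us ! k) (xs ! i)" for k i
  define \<Sigma> where "\<Sigma> = (\<Sum>k<?n. \<Sum>i<?n. T k * g i * M k i)"
  have X: "xmat e = mat ?n ?n (\<lambda>(i, j). U $$ (i, j) * c j)"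
    using xs us e(2) by (auto simp: xmat_def frame_mat_def U_def cu intro!: eq_matI)
  have detX: "Determinant.det (xmat e) = N * Determinant.det U"
    unfolding X N_def by (rule det_scale_columns[OF U])
  have cof: "cofactor (xmat e) i k = (\<Prod>j\<in>{..<?n} - {k}. c j) * (Determinant.det U * inner (us ! k) (xs ! i))"
    if "i < ?n" "k < ?n" for i k
    unfolding X cofactor_scale_columns[OF U that] cofactor_orthogonal[OF U UU that]
    using that xs us by (simp add: U_def frame_mat_def inner_commute)
  have "(\<Sum>i<?n. g i * (\<Sum>k<?n. inner (yv i) (snd (e ! k)) * cofactor (xmat e) i k))
    = (\<Sum>i<?n. \<Sum>k<?n. Determinant.det U * (T k * g i * M k i))"
    unfolding sum_distrib_left
    by (intro sum.cong refl) (simp add: cof dv T_def M_def inner_commute)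
  also have "\<dots> = Determinant.det U * \<Sigma>"
    unfolding \<Sigma>_def by (subst sum.swap) (simp add: sum_distrib_left)
  finally have \<Theta>e: "\<Theta> e = tw_C ls * (Determinant.det U * ((1 - S) * N + \<Sigma>))"
    unfolding \<Theta>_eq[OF e(2)] g_def S_def detX by (simp add: algebra_simps)
  then have \<Theta>abs: "\<bar>\<Theta> e\<bar> = tw_C ls * \<bar>(1 - S) * N + \<Sigma>\<bar>"
    using tw_C_lam(2) dU by (simp add: abs_mult)
  have vv: "inner (v i) (v j) = 0" if "i < ?n" "j < ?n" "i \<noteq> j" for i j
    using split[OF that] by (simp add: v_def sgn_div_norm)
  have v1: "inner (v k) (v k) \<le> 1" for k
    by (simp add: v_def norm_sgn flip: power2_norm_eq_inner)
  have y1: "inner (yv k) (yv k) \<le> 1" for k by (simp add: yv_inner)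
  have u1: "inner (us ! i) (us ! j) = (if i = j then 1 else 0)" if "i < ?n" "j < ?n" for i j
    using orthonormal_list_inner[OF us(1)] us(2) that by simp
  have x1: "inner (xs ! i) (xs ! j) = (if i = j then 1 else 0)" if "i < ?n" "j < ?n" for i j
    using orthonormal_list_inner[OF xs(1)] xs(2) that by simp
  have row: "(\<Sum>i\<in>J. \<bar>M k i\<bar>) \<le> 1" if "k < ?n" "J \<subseteq> {..<?n}" for k J
    unfolding M_def
  proof (rule abs_prod_sum_le_1)
    have J: "finite J" using that finite_subset by blast
    have "(\<Sum>i\<in>J. (inner (v k) (yv i))\<^sup>2) \<le> inner (v k) (v k)"
      by (rule bessel_inequality[OF J]) (auto simp: yv_inner)
    then show "(\<Sum>i\<in>J. (inner (v k) (yv i))\<^sup>2) \<le> 1" using v1[of k] by simp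
    have "(\<Sum>i\<in>J. (inner (us ! k) (xs ! i))\<^sup>2) \<le> inner (us ! k) (us ! k)"
      by (rule bessel_inequality[OF J]) (use that x1 in \<open>auto simp: subset_iff\<close>)
    then show "(\<Sum>i\<in>J. (inner (us ! k) (xs ! i))\<^sup>2) \<le> 1" using u1[OF that(1) that(1)] by simp
  qed
  have col: "(\<Sum>k\<in>K. \<bar>M k i\<bar>) \<le> 1" if "i < ?n" "K \<subseteq> {..<?n}" for i K
    unfolding M_def
  proof (rule abs_prod_sum_le_1)
    have K: "finite K" using that finite_subset by blast
    have "(\<Sum>k\<in>K. (inner (yv i) (v k))\<^sup>2) \<le> inner (yv i) (yv i)"
      by (rule bessel_inequality[OF K]) (use that vv v1 in \<open>auto simp: subset_iff\<close>)
    then show "(\<Sum>k\<in>K. (inner (v k) (yv i))\<^sup>2) \<le> 1" using y1[of i] by (simp add: inner_commute)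
    have "(\<Sum>k\<in>K. (inner (xs ! i) (us ! k))\<^sup>2) \<le> inner (xs ! i) (xs ! i)"
      by (rule bessel_inequality[OF K]) (use that u1 in \<open>auto simp: subset_iff\<close>)
    then show "(\<Sum>k\<in>K. (inner (us ! k) (xs ! i))\<^sup>2) \<le> 1" using x1[OF that(1) that(1)] by (simp add: inner_commute)
  qed
  have c0: "0 \<le> c k" and d0: "0 \<le> d k" for k by (simp_all add: c_def d_def)
  have T0: "0 \<le> T k" for k unfolding T_def using c0 d0 by (simp add: prod_nonneg)
  \<comment> \<open>\<open>p\<close> is fixed once. Both the unperturbed weights and those lowered
    by a multiple of \<open>lam\<close> are compared with it, so that the two bounds can be
    subtracted.\<close>
  obtain p where p: "bij_betw p {..<?n} {..<?n}" and tr: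
    "\<And>h. (\<And>i. i < ?n \<Longrightarrow> 0 \<le> h i) \<Longrightarrow> (\<And>i j. i < ?n \<Longrightarrow> j < ?n \<Longrightarrow> lam i \<le> lam j \<Longrightarrow> h i \<le> h j) \<Longrightarrow>
      (\<Sum>k<?n. \<Sum>i<?n. T k * h i * \<bar>M k i\<bar>) \<le> (\<Sum>k<?n. T k * h (p k))"
    using trace_rearrangement[where n = ?n and M = M and f = T and l = lam, OF row col T0] by blast
  \<comment> \<open>\<open>weight_mono\<close> gives the sign of the weights by comparison with 0,
    and their order from two distinct indices, whose terms together are at most
    \<open>S\<close>.\<close>
  have weights: "(\<Sum>k<?n. \<Sum>i<?n. T k * (g i - \<epsilon> * lam i) * M k i) \<le> (\<Sum>k<?n. T k * (g (p k) - \<epsilon> * lam (p k)))"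
    "(\<Sum>k<?n. \<Sum>i<?n. T k * (g i - \<epsilon> * lam i) * \<bar>M k i\<bar>) \<le> (\<Sum>k<?n. T k * (g (p k) - \<epsilon> * lam (p k)))"
    if \<epsilon>: "\<epsilon> \<le> (1 - S) / 2" for \<epsilon>
  proof -
    have S1: "S < 1" using S_less by (simp add: S_def)
    have s0: "0 \<le> (lam i)\<^sup>2 / (1 + (lam i)\<^sup>2)" for i by simp
    have nn: "0 \<le> g i - \<epsilon> * lam i" if "i < ?n" for i
    proof -
      have "(lam i)\<^sup>2 / (1 + (lam i)\<^sup>2) \<le> S"
        unfolding S_def tw_S_lam by (rule member_le_sum) (use that s0 in auto)
      then show ?thesis
        using weight_mono[of 0 "lam i" S \<epsilon>] lam_nonneg S1 \<epsilon> by (simp add: g_def)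
    qed
    moreover have mono: "g i - \<epsilon> * lam i \<le> g j - \<epsilon> * lam j" if "i < ?n" "j < ?n" "lam i \<le> lam j" for i j
    proof (cases "i = j")
      case False
      have "(\<Sum>k\<in>{i, j}. (lam k)\<^sup>2 / (1 + (lam k)\<^sup>2)) \<le> S"
        unfolding S_def tw_S_lam by (rule sum_mono2) (use that s0 in auto)
      then show ?thesis
        using weight_mono[of "lam i" "lam j" S \<epsilon>] lam_nonneg S1 \<epsilon> that False by (simp add: g_def)
    qed simp
    ultimately show b: "(\<Sum>k<?n. \<Sum>i<?n. T k * (g i - \<epsilon> * lam i) * \<bar>M k i\<bar>) \<le> (\<Sum>k<?n. T k * (g (p k) - \<epsilon> * lam (p k)))"
      by (rule tr)
    have "(\<Sum>k<?n. \<Sum>i<?n. T k * (g i - \<epsilon> * lam i) * M k i) \<le> (\<Sum>k<?n. \<Sum>i<?n. T k * (g i - \<epsilon> * lam i) * \<bar>M k i\<bar>)"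
      by (intro sum_mono mult_left_mono mult_nonneg_nonneg) (use T0 nn in auto)
    with b show "(\<Sum>k<?n. \<Sum>i<?n. T k * (g i - \<epsilon> * lam i) * M k i) \<le> (\<Sum>k<?n. T k * (g (p k) - \<epsilon> * lam (p k)))"
      by linarith
  qed
  have S1: "S < 1" using S_less by (simp add: S_def)
  define Q where "Q = (\<Sum>k<?n. g (p k) * T k)"
  have g0: "0 \<le> g i" for i using lam_nonneg by (simp add: g_def)
  have \<Sigma>Q: "\<bar>\<Sigma>\<bar> \<le> Q"
  proof -
    have "\<bar>\<Sigma>\<bar> \<le> (\<Sum>k<?n. \<Sum>i<?n. T k * g i * \<bar>M k i\<bar>)"
      unfolding \<Sigma>_def
      by (intro order_trans[OF sum_abs] sum_mono) (use T0 g0 in \<open>simp add: abs_mult\<close>)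
    also have "\<dots> \<le> Q" using weights(2)[of 0] S1 by (simp add: Q_def mult.commute)
    finally show ?thesis .
  qed
  have Sp: "S = (\<Sum>k<?n. (lam (p k))\<^sup>2 / (1 + (lam (p k))\<^sup>2))"
    unfolding S_def tw_S_lam using sum.reindex_bij_betw[OF p, of "\<lambda>i. (lam i)\<^sup>2 / (1 + (lam i)\<^sup>2)"] by simp
  have Cp: "(tw_C ls)\<^sup>2 = (\<Prod>k<?n. 1 + (lam (p k))\<^sup>2)"
    unfolding tw_C_lam using prod.reindex_bij_betw[OF p, of "\<lambda>i. 1 + (lam i)\<^sup>2"] by simp
  have torus: "((1 - S) * N + Q)\<^sup>2 * (tw_C ls)\<^sup>2 \<le> 1"
    "((1 - S) * N + Q)\<^sup>2 * (tw_C ls)\<^sup>2 = 1 \<Longrightarrow> k < ?n \<Longrightarrow> d k = lam (p k) * c k" for k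
    using torus_bound[where l = "\<lambda>k. lam (p k)" and c = c and d = d and n = ?n, OF cd] S1
    unfolding Sp Cp N_def Q_def g_def T_def by blast+
  have N0: "0 \<le> N" unfolding N_def using c0 by (simp add: prod_nonneg)
  have Q0: "0 \<le> Q" unfolding Q_def using g0 T0 by (simp add: sum_nonneg)
  define B where "B = tw_C ls * ((1 - S) * N + Q)"
  have B0: "0 \<le> B" unfolding B_def using tw_C_lam(2) S1 N0 Q0 by simp
  have B2: "B\<^sup>2 = ((1 - S) * N + Q)\<^sup>2 * (tw_C ls)\<^sup>2" by (simp add: B_def power_mult_distrib mult.commute)
  have "B\<^sup>2 \<le> 1" unfolding B2 by (rule torus(1))
  then have B1: "B \<le> 1" using B0 by (simp add: power_le_one_iff abs_square_le_1)
  have "0 \<le> (1 - S) * N" using S1 N0 by simp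
  then have "\<bar>(1 - S) * N + \<Sigma>\<bar> \<le> (1 - S) * N + Q" using \<Sigma>Q by linarith
  then have \<Theta>B: "\<bar>\<Theta> e\<bar> \<le> B"
    unfolding \<Theta>abs B_def using tw_C_lam(2) by (intro mult_left_mono) auto
  then show "\<bar>\<Theta> e\<bar> \<le> 1" using B1 by simp
  assume eq: "\<bar>\<Theta> e\<bar> = 1"
  then have "B = 1" using \<Theta>B B1 by simp
  then have "((1 - S) * N + Q)\<^sup>2 * (tw_C ls)\<^sup>2 = 1" using B2 by simp
  then have dc: "d k = lam (p k) * c k" if "k < ?n" for k by (rule torus(2)) (use that in auto)
  \<comment> \<open>A vanishing cosine would make the sine \<open>d k\<close> vanish as
    well.\<close>
  have cpos: "0 < c k" if "k < ?n" for k
    using dc[OF that] cd[OF that] c0[of k] by (cases "c k = 0") auto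
  then have Npos: "0 < N" unfolding N_def by (intro prod_pos) auto
  have TN: "T k = N * lam (p k)" if "k < ?n" for k
    using that by (simp add: T_def N_def dc prod.remove[of "{..<?n}" k] mult_ac)
  have "\<bar>(1 - S) * N + \<Sigma>\<bar> = (1 - S) * N + Q"
    using eq \<open>B = 1\<close> tw_C_lam(2) unfolding \<Theta>abs B_def by (metis mult_left_cancel less_irrefl)
  moreover have "(1 - S) * N > 0" using S1 Npos by simp
  \<comment> \<open>The other sign in the absolute value would give
    \<open>\<Sigma> < - Q\<close>.\<close>
  ultimately have "\<Sigma> = Q" using \<Sigma>Q by (auto simp: abs_if split: if_splits)
  define \<epsilon> where "\<epsilon> = (1 - S) / 2"
  have \<epsilon>: "\<epsilon> > 0" using S1 by (simp add: \<epsilon>_def)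
  have "\<Sigma> - \<epsilon> * (\<Sum>k<?n. \<Sum>i<?n. T k * lam i * M k i) \<le> Q - \<epsilon> * (\<Sum>k<?n. T k * lam (p k))"
    using weights(1)[of \<epsilon>] unfolding \<Sigma>_def Q_def
    by (simp add: \<epsilon>_def algebra_simps sum_subtractf sum_distrib_left)
  then have "(\<Sum>k<?n. T k * lam (p k)) \<le> (\<Sum>k<?n. \<Sum>i<?n. T k * lam i * M k i)"
    using \<epsilon> \<open>\<Sigma> = Q\<close> by simp
  then have "N * (\<Sum>k<?n. (lam (p k))\<^sup>2) \<le> N * (\<Sum>k<?n. \<Sum>i<?n. lam (p k) * lam i * M k i)"
    by (simp add: TN sum_distrib_left power2_eq_square mult_ac)
  \<comment> \<open>The plane is the graph of the map \<open>B\<close> taking \<open>us ! k\<close>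
    to \<open>lam (p k) *\<^sub>R v k\<close>. The right side is the Hilbert-Schmidt product of
    \<open>A\<close> and \<open>B\<close>; the left side is the squared norm of \<open>A\<close> by
    \<open>nA\<close> and bounds that of \<open>B\<close>.\<close>
  then have big: "(\<Sum>k<?n. (lam (p k))\<^sup>2) \<le> (\<Sum>k<?n. \<Sum>i<?n. lam (p k) * lam i * M k i)"
    using Npos by simp
  have inner_Au: "inner (v k) (A (us ! k)) = (\<Sum>i<?n. lam i * M k i)" for k
    by (subst A_expand) (simp add: inner_sum_right M_def mult_ac)
  have "(\<Sum>k<?n. (norm (A (us ! k)))\<^sup>2) = (\<Sum>i<?n. \<Sum>k<?n. (lam i)\<^sup>2 * (inner (us ! k) (xs ! i))\<^sup>2)"
    unfolding norm_A by (rule sum.swap)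
  also have "\<dots> = (\<Sum>i<?n. (lam i)\<^sup>2)"
  proof (rule sum.cong[OF refl])
    fix i assume i: "i \<in> {..<?n}"
    have "(\<Sum>k<?n. (inner (us ! k) (xs ! i))\<^sup>2) = 1"
      using orthonormal_list_parseval[OF us(1), of "xs ! i" "xs ! i"] uspan us(2) x1[of i i] i
      by (simp add: power2_eq_square inner_commute)
    then show "(\<Sum>k<?n. (lam i)\<^sup>2 * (inner (us ! k) (xs ! i))\<^sup>2) = (lam i)\<^sup>2"
      by (simp flip: sum_distrib_left)
  qed
  also have "\<dots> = (\<Sum>k<?n. (lam (p k))\<^sup>2)" using sum.reindex_bij_betw[OF p, of "\<lambda>i. (lam i)\<^sup>2"] by simp
  finally have nA: "(\<Sum>k<?n. (norm (A (us ! k)))\<^sup>2) = (\<Sum>k<?n. (lam (p k))\<^sup>2)" .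
  \<comment> \<open>An inequality, since \<open>v k\<close> may be zero. Summed over
    \<open>k\<close> it makes the squared Hilbert-Schmidt norm of \<open>A - B\<close> at most
    0.\<close>
  have "(norm (A (us ! k) - lam (p k) *\<^sub>R v k))\<^sup>2 \<le>
      (norm (A (us ! k)))\<^sup>2 - 2 * (\<Sum>i<?n. lam (p k) * lam i * M k i) + (lam (p k))\<^sup>2" for k
  proof -
    have "(norm (A (us ! k) - lam (p k) *\<^sub>R v k))\<^sup>2 =
      (norm (A (us ! k)))\<^sup>2 - 2 * (lam (p k) * inner (v k) (A (us ! k))) + (lam (p k))\<^sup>2 * inner (v k) (v k)"
      unfolding power2_norm_eq_inner
      by (simp add: inner_diff_left inner_diff_right inner_commute power2_eq_square algebra_simps)
    moreover have "(lam (p k))\<^sup>2 * inner (v k) (v k) \<le> (lam (p k))\<^sup>2 * 1"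
      by (intro mult_left_mono v1) simp
    ultimately show ?thesis unfolding inner_Au by (simp add: sum_distrib_left mult.assoc)
  qed
  then have "(\<Sum>k<?n. (norm (A (us ! k) - lam (p k) *\<^sub>R v k))\<^sup>2) \<le>
    (\<Sum>k<?n. (norm (A (us ! k)))\<^sup>2 - 2 * (\<Sum>i<?n. lam (p k) * lam i * M k i) + (lam (p k))\<^sup>2)"
    by (rule sum_mono)
  also have "\<dots> \<le> 0" using big nA by (simp add: sum.distrib sum_subtractf flip: sum_distrib_left)
  finally have z: "(\<Sum>k<?n. (norm (A (us ! k) - lam (p k) *\<^sub>R v k))\<^sup>2) = 0"
    by (intro antisym sum_nonneg) auto
  show "snd (e ! k) = A (fst (e ! k))" if k: "k < ?n" for k
  proof -
    have "(norm (A (us ! k) - lam (p k) *\<^sub>R v k))\<^sup>2 = 0"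
      using z k by (subst (asm) sum_nonneg_eq_0_iff) auto
    then have "A (us ! k) = lam (p k) *\<^sub>R v k" by simp
    then show ?thesis using k lin by (simp add: cu dv dc linear_cmul mult.commute)
  qed
qed

end

section \<open>Adapted coordinates\<close>

lemma frame_expand:
  fixes e vs :: "'a::euclidean_space list"
  assumes "orthonormal_list e" "length e = n" "length vs = n" "set vs \<subseteq> span (set e)" "j < n"
  shows "vs ! j = (\<Sum>k<n. frame_mat vs e $$ (j, k) *\<^sub>R e ! k)"
proof -
  have "vs ! j \<in> span (set e)" using assms by auto
  then show ?thesis
    using orthonormal_list_expand[OF assms(1)] assms by (simp add: frame_mat_def)
qed

lemma gram_frame:
  fixes e vs :: "'a::euclidean_space list"
  assumes "orthonormal_list e" "length e = n" "length vs = n" "set vs \<subseteq> span (set e)"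
  shows "wedge (map inner vs) vs = (Determinant.det (frame_mat vs e))\<^sup>2"
proof -
  let ?M = "frame_mat vs e"
  have M: "?M \<in> carrier_mat n n" using assms by (simp add: frame_mat_def)
  have "mat n n (\<lambda>(i, j). inner (vs ! i) (vs ! j)) = ?M * transpose_mat ?M"
  proof (rule eq_matI)
    fix i j assume "i < dim_row (?M * transpose_mat ?M)" "j < dim_col (?M * transpose_mat ?M)"
    then have ij: "i < n" "j < n" using M by auto
    then have "vs ! i \<in> span (set e)" using assms by auto
    then show "mat n n (\<lambda>(i, j). inner (vs ! i) (vs ! j)) $$ (i, j) = (?M * transpose_mat ?M) $$ (i, j)"
      using ij M assms orthonormal_list_parseval[OF assms(1), of "vs ! i" "vs ! j"]
      by (subst mat_mult_entry[where n = n and k = n and m = n]) (auto simp: frame_mat_def)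
  qed (use M in auto)
  moreover have "wedge (map inner vs) vs = Determinant.det (mat n n (\<lambda>(i, j). inner (vs ! i) (vs ! j)))"
    unfolding wedge_def using assms by (auto intro!: arg_cong[of _ _ Determinant.det] eq_matI)
  ultimately show ?thesis
    using M by (simp add: det_mult[where n = n] det_transpose power2_eq_square)
qed

text \<open>It puts the arguments of a form into a plane of the right dimension without a prior
  proof that they are independent.\<close>

lemma ex_superspace:
  fixes S :: "'a::euclidean_space set"
  assumes "finite S" "card S \<le> n" "n \<le> DIM('a)"
  obtains P where "subspace P" "S \<subseteq> P" "dim P = n"
proof -
  obtain B where B: "B \<subseteq> S" "independent B" "S \<subseteq> span B"
    using maximal_independent_subset by metis
  obtain C where C: "B \<subseteq> C" "independent C" "UNIV \<subseteq> span C"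
    using maximal_independent_subset_extend[of B UNIV] B by auto
  have "finite C" using C(2) independent_imp_finite by blast
  have "card C = DIM('a)"
    using dim_eq_card_independent[OF C(2)] C(3) by (metis dim_UNIV dim_span top.extremum_uniqueI)
  moreover have "card B \<le> n" using card_mono[OF assms(1) B(1)] assms(2) by simp
  ultimately obtain E where E: "B \<subseteq> E" "E \<subseteq> C" "card E = n"
    using exists_subset_between[of B n C] C(1) \<open>finite C\<close> assms(3) by auto
  have "independent E" using C(2) E(2) independent_mono by blast
  then have "dim (span E) = n" using E(3) by (simp add: dim_eq_card_independent)
  moreover have "S \<subseteq> span E" using B(3) E(1) span_mono by blast
  ultimately show ?thesis using that subspace_span by blast
qed

lemma orthonormal_list_flip:
  assumes "orthonormal_list e"
  shows "orthonormal_list (e[0 := - e ! 0])"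
proof -
  have "e[0 := - e ! 0] ! k = (if k = 0 then - e ! 0 else e ! k)" if "k < length e" for k
    using that by (cases k) auto
  then show ?thesis using assms unfolding orthonormal_list_def by (auto simp del: nth_list_update_eq)
qed

text \<open>The matrix \<open>K\<close> of \<open>e\<close> in terms of \<open>bs\<close> has the
  inverse \<open>frame_mat bs e\<close>, so its determinant is nonzero; negating the first vector
  negates row 0 of \<open>K\<close> and so the determinant.\<close>

lemma orientation_cases:
  fixes bs e :: "'a::euclidean_space list"
  assumes bs: "ordered_basis P bs" and e: "orthonormal_list e" "set e \<subseteq> P" "length e = length bs"
    and sub: "subspace P" and pos: "0 < length bs"
  shows "same_orientation bs e \<or> same_orientation bs (e[0 := - e ! 0])"
proof -
  define n where "n = length bs"
  have spb: "span (set bs) = P" and dis: "distinct bs" using bs by (auto simp: ordered_basis_def)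
  have spe: "span (set e) = P"
    using orthonormal_list_span[OF e(1) sub e(2)] ordered_basis_length[OF bs] e(3) by simp
  have "\<exists>u. e ! i = (\<Sum>j<n. u (bs ! j) *\<^sub>R bs ! j)" if "i < n" for i
  proof -
    have "e ! i \<in> span (set bs)" using that e spb by (auto simp: n_def)
    then obtain u where u: "e ! i = (\<Sum>v\<in>set bs. u v *\<^sub>R v)" by (auto simp: span_finite)
    have "bij_betw ((!) bs) {..<n} (set bs)" using dis by (auto simp: n_def intro: bij_betw_nth)
    then have "(\<Sum>v\<in>set bs. u v *\<^sub>R v) = (\<Sum>j<n. u (bs ! j) *\<^sub>R bs ! j)"
      by (simp add: sum.reindex_bij_betw[symmetric])
    then show ?thesis using u by auto
  qed
  then obtain u where u: "\<And>i. i < n \<Longrightarrow> e ! i = (\<Sum>j<n. u i (bs ! j) *\<^sub>R bs ! j)" by metis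
  define K where "K = mat n n (\<lambda>(i, j). u i (bs ! j))"
  have K: "K \<in> carrier_mat n n" by (simp add: K_def)
  have eK: "e ! i = (\<Sum>j<n. K $$ (i, j) *\<^sub>R bs ! j)" if "i < n" for i
    using u[OF that] that by (simp add: K_def)
  let ?M = "frame_mat bs e"
  have M: "?M \<in> carrier_mat n n" using e by (simp add: frame_mat_def n_def)
  have "K * ?M = 1\<^sub>m n"
  proof (rule eq_matI)
    fix i j assume "i < dim_row (1\<^sub>m n :: real mat)" "j < dim_col (1\<^sub>m n :: real mat)"
    then have ij: "i < n" "j < n" by auto
    have "(K * ?M) $$ (i, j) = (\<Sum>l<n. K $$ (i, l) * inner (bs ! l) (e ! j))"
      using mat_mult_entry[OF K M ij] ij e by (simp add: frame_mat_def n_def)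
    also have "\<dots> = inner (e ! i) (e ! j)" by (subst eK[OF ij(1)]) (simp add: inner_sum_left)
    finally show "(K * ?M) $$ (i, j) = 1\<^sub>m n $$ (i, j)"
      using ij orthonormal_list_inner[OF e(1)] e(3) by (simp add: n_def)
  qed (use K M in auto)
  then have "Determinant.det K * Determinant.det ?M = 1" using det_mult[OF K M] by simp
  then consider "Determinant.det K > 0" | "Determinant.det K < 0"
    by (metis linorder_neqE_linordered_idom mult_zero_left zero_neq_one)
  then show ?thesis
  proof cases
    case 1
    then show ?thesis unfolding same_orientation_def using K eK e(3) n_def by auto
  next
    case 2
    define K' where "K' = multrow 0 (-1) K"
    have "Determinant.det K' = - Determinant.det K"
      unfolding K'_def using det_multrow[of 0 n K "-1"] K pos by (simp add: n_def)
    moreover have "e[0 := - e ! 0] ! i = (\<Sum>j<n. K' $$ (i, j) *\<^sub>R bs ! j)" if "i < n" for i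
    proof (cases "i = 0")
      case True
      then show ?thesis using that K e(3) eK[of 0] by (simp add: K'_def n_def sum_negf)
    next
      case False
      then show ?thesis using that K eK[of i] by (simp add: K'_def n_def)
    qed
    moreover have "K' \<in> carrier_mat n n" using K by (simp add: K'_def)
    ultimately have "same_orientation bs (e[0 := - e ! 0])"
      unfolding same_orientation_def n_def[symmetric] using 2 e(3) n_def
      by (intro conjI bexI[of _ K']) simp_all
    then show ?thesis ..
  qed
qed

text \<open>It ensures that the choice in \<open>form_value\<close> picks a positively oriented
  orthonormal frame.\<close>

lemma oriented_plane_orthonormal:
  assumes "oriented_plane n P" "0 < n"
  shows "\<exists>es. es \<in> snd P \<and> orthonormal_list es"
proof -
  obtain bs where P: "subspace (fst P)" "dim (fst P) = n" and bs: "ordered_basis (fst P) bs"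
    and sP: "snd P = {cs. ordered_basis (fst P) cs \<and> same_orientation bs cs}"
    using assms by (auto simp: oriented_plane_def)
  obtain e where e: "orthonormal_list e" "length e = n" "set e \<subseteq> fst P"
    using ex_diagonalizing_frame[OF linear_id P(1)] P(2) by auto
  have lb: "length bs = n" using ordered_basis_length[OF bs] P(2) by simp
  let ?e = "e[0 := - e ! 0]"
  have "set ?e \<subseteq> insert (- e ! 0) (set e)" by (rule set_update_subset_insert)
  moreover have "e ! 0 \<in> fst P" using e assms(2) by (metis nth_mem subsetD)
  then have "- e ! 0 \<in> fst P" using P(1) by (rule subspace_neg[rotated])
  ultimately have "set ?e \<subseteq> fst P" using e(3) by auto
  then have "ordered_basis (fst P) e" "ordered_basis (fst P) ?e"
    using e P orthonormal_list_flip[OF e(1)] by (auto intro!: orthonormal_list_ordered_basis)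
  then show ?thesis
    using orientation_cases[OF bs e(1,3) _ P(1)] lb e(1,2) assms(2) orthonormal_list_flip[OF e(1)]
    unfolding sP by auto
qed

section \<open>Existence of adapted coordinates and uniqueness of the singular values\<close>

lemma standard_basis:
  "ordered_basis UNIV (standard_basis :: (real ^ 'n::{finite,linorder}) list)"
  "length (standard_basis :: (real ^ 'n::{finite,linorder}) list) = CARD('n)"
proof -
  have "set (standard_basis :: (real ^ 'n::{finite,linorder}) list) = Basis"
    by (auto simp: standard_basis_def Basis_vec_def)
  moreover have "distinct (standard_basis :: (real ^ 'n::{finite,linorder}) list)"
    by (auto simp: standard_basis_def distinct_map inj_on_def axis_eq_axis)
  ultimately show "ordered_basis UNIV (standard_basis :: (real ^ 'n::{finite,linorder}) list)"
    by (simp add: ordered_basis_def independent_Basis)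
  show "length (standard_basis :: (real ^ 'n::{finite,linorder}) list) = CARD('n)"
    by (simp add: standard_basis_def)
qed

text \<open>Singular value decomposition: a diagonalizing frame has orthogonal images of decreasing
  length, so the nonzero ones come first and are normalized to \<open>ys\<close>.\<close>

lemma ex_adapted_coordinates:
  fixes A :: "real ^ 'n::{finite,linorder} \<Rightarrow> real ^ 'm"
  assumes lin: "linear A"
  shows "\<exists>xs ys ls. adapted_coordinates A xs ys ls"
proof -
  let ?n = "CARD('n)" and ?m = "CARD('m)"
  obtain es where es: "orthonormal_list es" "length es = ?n"
    and orth: "\<forall>i<length es. \<forall>j<length es. i \<noteq> j \<longrightarrow> inner (A (es ! i)) (A (es ! j)) = 0"
    and sorted: "\<forall>i j. i \<le> j \<longrightarrow> j < length es \<longrightarrow> norm (A (es ! j)) \<le> norm (A (es ! i))"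
    using ex_diagonalizing_frame[OF lin subspace_UNIV] by auto
  define f where "f i = A (es ! i)" for i
  \<comment> \<open>\<open>r\<close> is the rank; the alternative \<open>?n \<le> i\<close> provides
    a witness when no image vanishes.\<close>
  define r where "r = (LEAST i. ?n \<le> i \<or> f i = 0)"
  have r: "?n \<le> r \<or> f r = 0" unfolding r_def by (rule LeastI[of _ ?n]) simp
  have rn: "r \<le> ?n" unfolding r_def by (rule Least_le) simp
  have fr: "f i \<noteq> 0" "i < ?n" if "i < r" for i
    using not_less_Least[OF that[unfolded r_def]] by auto
  have f0: "f i = 0" if "r \<le> i" "i < ?n" for i
    using sorted[rule_format, of r i] r that es(2) by (auto simp: f_def)
  have forth: "inner (f i) (f j) = 0" if "i < ?n" "j < ?n" "i \<noteq> j" for i j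
    using orth that es(2) by (auto simp: f_def)
  have inj: "inj_on f {..<r}"
    by (rule inj_onI) (metis forth fr inner_eq_zero_iff lessThan_iff)
  have "pairwise real_inner_class.orthogonal (f ` {..<r})"
    using forth fr by (auto simp: pairwise_def real_inner_class.orthogonal_def)
  then have "independent (f ` {..<r})"
    by (rule pairwise_orthogonal_independent) (use fr in auto)
  then have "card (f ` {..<r}) \<le> DIM(real ^ 'm)" by (rule independent_card_le)
  then have rm: "r \<le> ?m" using inj by (simp add: card_image)
  obtain ys where ys: "orthonormal_list ys" "length ys = ?m"
    \<comment> \<open>The images are padded by zeros, as the target may have more dimensions than
      the domain.\<close>
    and fy: "\<And>k. k < ?m \<Longrightarrow> (if k < ?n then f k else 0) = norm (if k < ?n then f k else 0) *\<^sub>R ys ! k"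
    by (rule ex_orthonormal_directions[of "\<lambda>k. if k < ?n then f k else 0"]) (use forth in auto)
  define ls where "ls = map (\<lambda>i. norm (f i)) [0..<r]"
  have A_es: "A (es ! i) = (if i < length ls then (ls ! i) *\<^sub>R (ys ! i) else 0)" if "i < ?n" for i
    using fy[of i] f0[of i] rm that by (auto simp: ls_def f_def)
  have lspos: "\<forall>l\<in>set ls. l > 0" using fr by (auto simp: ls_def)
  have len: "length ls \<le> ?n" "length ls \<le> ?m" using rn rm by (auto simp: ls_def)
  have np: "0 < ?n" "0 < ?m" by simp_all
  consider "same_orientation standard_basis es" | "same_orientation standard_basis (es[0 := - es ! 0])"
    using orientation_cases[OF standard_basis(1) es(1), unfolded standard_basis(2)] es(2) by auto
  then show ?thesis
  proof cases
    case 1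
    then have "adapted_coordinates A es ys ls"
      unfolding adapted_coordinates_def using es ys len lspos A_es by blast
    then show ?thesis by blast
  next
    case 2
    \<comment> \<open>The first vectors of both bases are negated together, which corrects the
      orientation of the domain and keeps the singular value positive.\<close>
    have "A (es[0 := - es ! 0] ! i) = (if i < length ls then (ls ! i) *\<^sub>R (ys[0 := - ys ! 0] ! i) else 0)"
      if "i < ?n" for i
      using A_es[OF that] that es(2) ys(2) np lin len by (cases "i = 0") (auto simp: linear_neg)
    then have "adapted_coordinates A (es[0 := - es ! 0]) (ys[0 := - ys ! 0]) ls"
      unfolding adapted_coordinates_def
      using 2 es(2) ys(2) len lspos orthonormal_list_flip[OF es(1)] orthonormal_list_flip[OF ys(1)] by auto
    then show ?thesis by blast
  qed
qed

text \<open>Multiplicities determine the list up to order. This transfers the hypothesis from a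
  given list of singular values to the one in the chosen coordinates.\<close>

lemma tw_S_unique:
  assumes "nonzero_singular_values A ls" "nonzero_singular_values A ls'"
  shows "tw_S ls = tw_S ls'"
proof -
  have S: "tw_S ls = sum_list (map (\<lambda>l. l\<^sup>2 / (1 + l\<^sup>2)) ls)" for ls
    by (simp add: tw_S_def sum_list_sum_nth atLeast0LessThan)
  have "mset ls = mset ls'"
    using assms by (intro multiset_eqI) (simp add: nonzero_singular_values_def count_mset)
  then show ?thesis
    unfolding S by (simp flip: sum_mset_sum_list)
qed

context tw_coordinates
begin

text \<open>The eigenspace is spanned by the \<open>xs ! i\<close> with
  \<open>lam i = \<sigma>\<close>: pairing the eigenvector equation with any other
  \<open>xs ! i\<close> makes that coordinate vanish.\<close>

lemma singular_values: "nonzero_singular_values A ls"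
  unfolding nonzero_singular_values_def
proof
  fix \<sigma> :: real
  let ?E = "{v. adjoint A (A v) = \<sigma>\<^sup>2 *\<^sub>R v}"
  have pos: "\<forall>l\<in>set ls. l > 0" using adapted by (simp add: adapted_coordinates_def)
  show "count_list ls \<sigma> = (if \<sigma> > 0 then dim ?E else 0)"
  proof (cases "\<sigma> > 0")
    case False
    then show ?thesis using pos by (auto simp: count_list_0_iff)
  next
    case True
    define I where "I = {i. i < length ls \<and> ls ! i = \<sigma>}"
    have I: "I \<subseteq> {..<CARD('n)}" using ls by (auto simp: I_def)
    have cI: "count_list ls \<sigma> = card I"
      by (simp add: count_list_eq_length_filter length_filter_conv_card I_def eq_commute)
    define B where "B = (!) xs ` I"
    have "inj_on ((!) xs) {..<CARD('n)}"
      using orthonormal_list_independent(1)[OF xs(1)] xs(2) by (simp add: inj_on_nth)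
    then have cB: "card B = card I" unfolding B_def using I by (metis card_image inj_on_subset)
    have "B \<subseteq> set xs" using I xs(2) by (auto simp: B_def)
    then have iB: "independent B" using orthonormal_list_independent(2)[OF xs(1)] independent_mono by blast
    have ad: "inner w (adjoint A (A v)) = inner (A w) (A v)" for w v
      using adjoint_works[OF lin] by simp
    have subE: "subspace ?E"
      unfolding subspace_def
      by (simp add: linear_0[OF lin] linear_add[OF lin] linear_cmul[OF lin] scaleR_add_right mult.commute
          linear_0[OF adjoint_linear[OF lin]] linear_add[OF adjoint_linear[OF lin]] linear_cmul[OF adjoint_linear[OF lin]])
    have "B \<subseteq> ?E"
    proof
      fix b assume "b \<in> B"
      then obtain i where i: "i \<in> I" "b = xs ! i" by (auto simp: B_def)
      then have i': "i < CARD('n)" "lam i = \<sigma>" using I by (auto simp: I_def lam_def)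
      have "inner w (adjoint A (A b)) = inner w (\<sigma>\<^sup>2 *\<^sub>R b)" for w
      proof -
        have "inner (A w) (A b) = \<sigma> * inner (yv i) (A w)" using i i' by (simp add: A_xs inner_commute)
        also have "\<dots> = \<sigma>\<^sup>2 * inner w b"
          using i i' by (simp add: inner_yv_A power2_eq_square inner_commute[of w])
        finally show ?thesis by (simp add: ad)
      qed
      then have "adjoint A (A b) = \<sigma>\<^sup>2 *\<^sub>R b" using vector_eq_ldot by blast
      then show "b \<in> ?E" by simp
    qed
    then have "span B \<subseteq> ?E" by (rule span_minimal[OF _ subE])
    moreover have "?E \<subseteq> span B"
    proof
      fix v assume v: "v \<in> ?E"
      have z: "inner v (xs ! i) *\<^sub>R xs ! i \<in> span B" if i: "i < CARD('n)" for i
      proof (cases "i \<in> I")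
        case True
        then show ?thesis by (auto simp: B_def intro: span_mul span_base)
      next
        case False
        have "(lam i)\<^sup>2 * inner (xs ! i) v = \<sigma>\<^sup>2 * inner (xs ! i) v"
          using ad[of "xs ! i" v] v i by (auto simp: A_xs inner_yv_A power2_eq_square)
        moreover have "lam i \<noteq> \<sigma>" using False True by (auto simp: I_def lam_def)
        then have "(lam i)\<^sup>2 \<noteq> \<sigma>\<^sup>2" using True lam_nonneg[of i] by (simp add: power2_eq_iff)
        ultimately have "inner (xs ! i) v = 0" by simp
        then show ?thesis by (simp add: inner_commute span_zero)
      qed
      have "v = (\<Sum>i<CARD('n). inner v (xs ! i) *\<^sub>R xs ! i)"
        using orthonormal_list_expand[OF xs(1), of v] xs by simp
      then show "v \<in> span B" using z by (metis (no_types, lifting) lessThan_iff span_sum)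
    qed
    ultimately have "?E = span B" by blast
    then show ?thesis using True iB cB cI by (simp add: dim_span_eq_card_independent del: dim_span)
  qed
qed

end

section \<open>Calibrated planes\<close>

context tw_coordinates
begin

abbreviation "\<Gamma> \<equiv> range (\<lambda>v. (v, A v))"

lemma in_graph: "w \<in> \<Gamma> \<longleftrightarrow> snd w = A (fst w)"
  by (cases w) auto

section \<open>The oriented graph and its frames\<close>

lemma \<Theta>_graph_subset:
  assumes len: "length vs = CARD('n)" and sub: "set vs \<subseteq> \<Gamma>"
  shows "\<Theta> vs = tw_C ls * Determinant.det (xmat vs)"
proof (rule \<Theta>_graph[OF len])
  fix k assume "k < CARD('n)"
  then have "vs ! k \<in> set vs" using len by simp
  then have "vs ! k \<in> \<Gamma>" by (rule subsetD[OF sub])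
  then show "snd (vs ! k) = A (fst (vs ! k))" unfolding in_graph .
qed

lemma graph_subspace: "subspace \<Gamma>" "dim \<Gamma> = CARD('n)"
proof -
  have l: "linear (\<lambda>v. (v, A v))"
    using lin by (intro linearI) (simp_all add: linear_add linear_cmul)
  show "subspace \<Gamma>" by (rule linear_subspace_image[OF l subspace_UNIV])
  have "inj (\<lambda>v. (v, A v))" by (rule injI) simp
  then show "dim \<Gamma> = CARD('n)" using dim_image_eq[OF l, of UNIV] by simp
qed

text \<open>\<open>xs\<close> is positively oriented, and the matrix expressing
  \<open>map fst vs\<close> in \<open>xs\<close> is the transpose of \<open>xmat vs\<close>.\<close>

lemma same_orientation_xmat:
  assumes vs: "length vs = CARD('n)"
  shows "same_orientation standard_basis (map fst vs) \<longleftrightarrow> 0 < Determinant.det (xmat vs)"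
proof -
  let ?n = "CARD('n)"
  have X: "xmat vs \<in> carrier_mat ?n ?n" using vs xs by (simp add: xmat_def frame_mat_def)
  have "same_orientation standard_basis (map fst vs) \<longleftrightarrow> same_orientation xs (map fst vs)"
    using orient same_orientation_trans same_orientation_sym by blast
  also have "\<dots> \<longleftrightarrow> 0 < Determinant.det (xmat vs)"
  proof
    assume "same_orientation xs (map fst vs)"
    then obtain M where M: "M \<in> carrier_mat ?n ?n" "Determinant.det M > 0"
      "\<And>i. i < ?n \<Longrightarrow> map fst vs ! i = (\<Sum>j<?n. M $$ (i, j) *\<^sub>R xs ! j)"
      using xs(2) by (auto simp: same_orientation_def)
    have "xmat vs = transpose_mat M"
    proof (rule eq_matI)
      fix i j assume "i < dim_row (transpose_mat M)" "j < dim_col (transpose_mat M)"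
      then have ij: "i < ?n" "j < ?n" using M by auto
      have "inner (xs ! i) (map fst vs ! j) = (\<Sum>k<?n. if k = i then M $$ (j, k) else 0)"
        unfolding M(3)[OF ij(2)] inner_sum_right inner_scaleR_right
        using orthonormal_list_inner[OF xs(1)] xs(2) ij by (intro sum.cong) auto
      then show "xmat vs $$ (i, j) = transpose_mat M $$ (i, j)"
        using ij M vs xs by (simp add: xmat_def frame_mat_def)
    qed (use X M in auto)
    then show "0 < Determinant.det (xmat vs)" using det_transpose[OF M(1)] M(2) by simp
  next
    assume p: "0 < Determinant.det (xmat vs)"
    have "map fst vs ! i = (\<Sum>j<?n. transpose_mat (xmat vs) $$ (i, j) *\<^sub>R xs ! j)" if "i < ?n" for i
      using orthonormal_list_expand[OF xs(1), of "map fst vs ! i"] that xs vs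
      by (simp add: xmat_def frame_mat_def inner_commute)
    then show "same_orientation xs (map fst vs)"
      unfolding same_orientation_def using X p vs xs(2) det_transpose[OF X]
      by (intro conjI bexI[of _ "transpose_mat (xmat vs)"]) auto
  qed
  finally show ?thesis .
qed

text \<open>The graph map is linear and inverts the projection, so frames in the graph are related
  by the same matrices as their projections.\<close>

lemma same_orientation_graph:
  assumes "set bs \<subseteq> \<Gamma>" "set cs \<subseteq> \<Gamma>"
  shows "same_orientation bs cs \<longleftrightarrow> same_orientation (map fst bs) (map fst cs)"
proof -
  have b: "bs ! i = (map fst bs ! i, A (map fst bs ! i))" if "i < length bs" for i
    using assms(1) nth_mem[OF that] that in_graph by (metis nth_map prod.collapse subsetD)
  have c: "cs ! i = (map fst cs ! i, A (map fst cs ! i))" if "i < length cs" for i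
    using assms(2) nth_mem[OF that] that in_graph by (metis nth_map prod.collapse subsetD)
  have "cs ! i = (\<Sum>j<length bs. (M $$ (i, j)) *\<^sub>R (bs ! j)) \<longleftrightarrow>
    map fst cs ! i = (\<Sum>j<length bs. (M $$ (i, j)) *\<^sub>R (map fst bs ! j))"
    if i: "i < length bs" and l: "length cs = length bs" for i and M :: "real mat"
  proof -
    have "(\<Sum>j<length bs. (M $$ (i, j)) *\<^sub>R (bs ! j)) = (\<Sum>j<length bs. (M $$ (i, j)) *\<^sub>R (map fst bs ! j, A (map fst bs ! j)))"
      by (intro sum.cong refl arg_cong2[where f = scaleR]) (use b in auto)
    also have "\<dots> = (\<Sum>j<length bs. (M $$ (i, j)) *\<^sub>R (map fst bs ! j), A (\<Sum>j<length bs. (M $$ (i, j)) *\<^sub>R (map fst bs ! j)))"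
      using lin by (simp add: linear_sum linear_cmul sum_prod)
    finally show ?thesis using c[of i] i l by auto
  qed
  then have "(\<forall>i<length bs. cs ! i = (\<Sum>j<length bs. (M $$ (i, j)) *\<^sub>R (bs ! j))) \<longleftrightarrow>
    (\<forall>i<length bs. map fst cs ! i = (\<Sum>j<length bs. (M $$ (i, j)) *\<^sub>R (map fst bs ! j)))"
    if "length cs = length bs" for M :: "real mat" using that by blast
  then show ?thesis
    unfolding same_orientation_def length_map by (intro conj_cong refl bex_cong) blast
qed

text \<open>The scalar is the reciprocal length of \<open>(xs ! i, A (xs ! i))\<close>, and these
  vectors are already orthogonal.\<close>

definition "graph_frame = map (\<lambda>i. (1 / sqrt (1 + (lam i)\<^sup>2)) *\<^sub>R (xs ! i, A (xs ! i))) [0..<CARD('n)]"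

lemma graph_frame:
  "orthonormal_list graph_frame" "length graph_frame = CARD('n)" "set graph_frame \<subseteq> \<Gamma>"
  "span (set graph_frame) = \<Gamma>" "\<Theta> graph_frame = 1" "0 < Determinant.det (xmat graph_frame)"
proof -
  let ?n = "CARD('n)"
  define s where "s i = 1 / sqrt (1 + (lam i)\<^sup>2)" for i
  have p: "0 < 1 + (lam i)\<^sup>2" for i by (simp add: add_pos_nonneg)
  have s: "0 < s i" "(s i)\<^sup>2 * (1 + (lam i)\<^sup>2) = 1" for i
    using p[of i] by (simp_all add: s_def power_divide)
  have nth: "graph_frame ! i = (s i *\<^sub>R xs ! i, s i *\<^sub>R A (xs ! i))" if "i < ?n" for i
    using that by (simp add: graph_frame_def s_def)
  show len: "length graph_frame = ?n" by (simp add: graph_frame_def)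
  show sub: "set graph_frame \<subseteq> \<Gamma>"
  proof
    fix w assume "w \<in> set graph_frame"
    then obtain i where "i < ?n" "w = graph_frame ! i" using len by (metis in_set_conv_nth)
    then show "w \<in> \<Gamma>" using lin by (simp add: nth in_graph linear_cmul)
  qed
  show on: "orthonormal_list graph_frame"
    unfolding orthonormal_list_def len
  proof (intro allI impI)
    fix i j assume ij: "i < ?n" "j < ?n"
    have "inner (graph_frame ! i) (graph_frame ! j) =
      s i * s j * (inner (xs ! i) (xs ! j) + lam i * lam j * inner (yv i) (yv j))"
      using ij by (simp add: nth inner_prod_def A_xs algebra_simps)
    also have "\<dots> = (if i = j then 1 else 0)"
    proof (cases "i = j")
      case True
      have "inner (xs ! i) (xs ! i) + lam i * lam i * inner (yv i) (yv i) = 1 + (lam i)\<^sup>2"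
        using orthonormal_list_inner[OF xs(1)] xs(2) ij by (simp add: yv_inner lam_def power2_eq_square)
      then have "s i * s i * (inner (xs ! i) (xs ! i) + lam i * lam i * inner (yv i) (yv i)) = 1"
        using s(2)[of i] by (simp only: power2_eq_square[of "s i"])
      then show ?thesis using True by simp
    next
      case False
      then show ?thesis using orthonormal_list_inner[OF xs(1)] xs(2) ij by (simp add: yv_inner)
    qed
    finally show "inner (graph_frame ! i) (graph_frame ! j) = (if i = j then 1 else 0)" .
  qed
  show "span (set graph_frame) = \<Gamma>"
    using orthonormal_list_span[OF on graph_subspace(1) sub] graph_subspace(2) len by simp
  \<comment> \<open>The horizontal parts are multiples of \<open>xs\<close>, so the matrix is
    diagonal and its determinant is the reciprocal of \<open>tw_C ls\<close>.\<close>
  have "xmat graph_frame = mat ?n ?n (\<lambda>(i, j). 1\<^sub>m ?n $$ (i, j) * s j)"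
    using xs(2) len orthonormal_list_inner[OF xs(1)]
    by (intro eq_matI) (auto simp: xmat_def frame_mat_def nth)
  then have det: "Determinant.det (xmat graph_frame) = (\<Prod>j<?n. s j)"
    using det_scale_columns[of "1\<^sub>m ?n" ?n s] by simp
  then show pos: "0 < Determinant.det (xmat graph_frame)" using s(1) by (simp add: prod_pos)
  have \<Theta>1: "\<Theta> graph_frame = tw_C ls * (\<Prod>j<?n. s j)"
    using \<Theta>_graph_subset[OF len sub] det by simp
  have "(\<Theta> graph_frame)\<^sup>2 = (\<Prod>j<?n. (s j)\<^sup>2 * (1 + (lam j)\<^sup>2))"
    unfolding \<Theta>1 power_mult_distrib tw_C_lam(1) by (simp add: prod.distrib prod_power_distrib mult.commute)
  then have "(\<Theta> graph_frame)\<^sup>2 = 1" using s(2) by simp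
  moreover have "0 < \<Theta> graph_frame" unfolding \<Theta>1 using tw_C_lam(2) pos det by simp
  ultimately show "\<Theta> graph_frame = 1" by (simp add: power2_eq_1_iff)
qed

lemma snd_graph_plane:
  "snd (graph_plane A) = {bs. ordered_basis \<Gamma> bs \<and> same_orientation standard_basis (map fst bs)}"
  "fst (graph_plane A) = \<Gamma>"
  by (simp_all add: graph_plane_def Let_def)

text \<open>\<open>graph_plane\<close> orients by projection, whereas \<open>oriented_plane\<close>
  asks for the class of a basis of the subspace itself; this matches the two.\<close>

lemma snd_graph_plane_frame:
  assumes "ordered_basis \<Gamma> es" "0 < Determinant.det (xmat es)"
  shows "snd (graph_plane A) = {cs. ordered_basis \<Gamma> cs \<and> same_orientation es cs}"
proof -
  have "length es = CARD('n)" using ordered_basis_length[OF assms(1)] graph_subspace(2) by simp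
  then have o: "same_orientation standard_basis (map fst es)" using same_orientation_xmat assms(2) by blast
  have "same_orientation standard_basis (map fst cs) \<longleftrightarrow> same_orientation es cs" if "ordered_basis \<Gamma> cs" for cs
    unfolding same_orientation_graph[OF ordered_basis_in[OF assms(1)] ordered_basis_in[OF that]]
    using o same_orientation_trans same_orientation_sym by blast
  then show ?thesis unfolding snd_graph_plane by blast
qed

lemma graph_frame_basis: "ordered_basis \<Gamma> graph_frame"
  using graph_frame graph_subspace by (intro orthonormal_list_ordered_basis) auto

lemma oriented_graph_plane: "oriented_plane CARD('n) (graph_plane A)"
  unfolding oriented_plane_def
  using graph_subspace graph_frame_basis snd_graph_plane_frame[OF graph_frame_basis graph_frame(6)] snd_graph_plane(2)
  by auto

lemma \<Theta>_frame:
  assumes e: "orthonormal_list e" "length e = CARD('n)" and vs: "length vs = CARD('n)" "set vs \<subseteq> span (set e)"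
  shows "\<Theta> vs = Determinant.det (frame_mat vs e) * \<Theta> e"
proof (rule \<Theta>_change_frame)
  show "frame_mat vs e \<in> carrier_mat CARD('n) CARD('n)" using e vs by (simp add: frame_mat_def)
qed (use frame_expand[OF e vs] in auto)

lemma form_value_graph_plane: "form_value \<Theta> (graph_plane A) = 1"
proof -
  \<comment> \<open>The value is computed for every admissible frame, hence for the chosen one: it
    is a determinant of absolute value 1, and the orientation makes it positive.\<close>
  have "\<Theta> es = 1" if es: "es \<in> snd (graph_plane A)" "orthonormal_list es" for es
  proof -
    have b: "ordered_basis \<Gamma> es" and o: "same_orientation standard_basis (map fst es)"
      using es(1) by (auto simp: snd_graph_plane)
    have len: "length es = CARD('n)" using ordered_basis_length[OF b] graph_subspace(2) by simp
    have sub: "set es \<subseteq> \<Gamma>" using ordered_basis_in[OF b] .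
    have "\<Theta> es = tw_C ls * Determinant.det (xmat es)"
      using \<Theta>_graph_subset[OF len sub] .
    then have "0 < \<Theta> es" using o same_orientation_xmat[OF len] tw_C_lam(2) by simp
    moreover have "\<Theta> es = Determinant.det (frame_mat es graph_frame)"
      using \<Theta>_frame[OF graph_frame(1,2) len] sub graph_frame(4,5) by simp
    moreover have "\<bar>Determinant.det (frame_mat es graph_frame)\<bar> = 1"
      using frame_mat_orthogonal(2)[OF es(2) graph_frame(1) len graph_frame(2)] sub graph_frame(4) by simp
    ultimately show ?thesis by simp
  qed
  moreover have "\<exists>es. es \<in> snd (graph_plane A) \<and> orthonormal_list es"
    using oriented_plane_orthonormal[OF oriented_graph_plane] by simp
  ultimately show ?thesis unfolding form_value_def by (metis (no_types, lifting) someI_ex)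
qed

text \<open>Principal angles: the frame diagonalizes the projection \<open>snd\<close> restricted to
  \<open>P\<close>.\<close>

lemma ex_split_frame:
  fixes P :: "((real ^ 'n::_) \<times> (real ^ 'm)) set"
  assumes "subspace P" "dim P = CARD('n)"
  obtains e where "orthonormal_list e" "length e = CARD('n)" "span (set e) = P"
    "\<And>i j. i < CARD('n) \<Longrightarrow> j < CARD('n) \<Longrightarrow> i \<noteq> j \<Longrightarrow> inner (snd (e ! i)) (snd (e ! j)) = 0"
proof -
  have "linear (snd :: (real ^ 'n::_) \<times> (real ^ 'm) \<Rightarrow> _)" by (rule linear_snd)
  from ex_diagonalizing_frame[OF this assms(1)]
  obtain e where e: "orthonormal_list e" "length e = dim P" "set e \<subseteq> P"
    "\<forall>i<length e. \<forall>j<length e. i \<noteq> j \<longrightarrow> inner (snd (e ! i)) (snd (e ! j)) = 0"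
    by (elim exE conjE) (rule that)
  then show ?thesis using that[of e] orthonormal_list_span[OF e(1) assms(1) e(3)] assms(2) by auto
qed

text \<open>The frame of the graph attains 1. For the bound, arguments of simple norm 1 are compared
  with a split frame of a plane containing them, the change of frame having determinant 1 or
  -1.\<close>

lemma comass_\<Theta>:
  assumes S: "tw_S ls < 1"
  shows "comass CARD('n) \<Theta> = 1"
proof -
  let ?C = "{\<bar>\<Theta> vs\<bar> | vs. length vs = CARD('n) \<and> simple_norm vs = 1}"
  have "wedge (map inner graph_frame) graph_frame = \<bar>Determinant.det (frame_mat graph_frame graph_frame)\<bar>\<^sup>2"
    unfolding power2_abs by (rule gram_frame[OF graph_frame(1,2,2) span_superset])
  then have "wedge (map inner graph_frame) graph_frame = 1"
    unfolding frame_mat_orthogonal(2)[OF graph_frame(1,1,2,2) span_superset] by simp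
  then have "1 \<in> ?C"
    using graph_frame(2,5) by (auto simp: simple_norm_def intro!: exI[of _ graph_frame])
  moreover have "\<bar>\<Theta> vs\<bar> \<le> 1" if vs: "length vs = CARD('n)" "simple_norm vs = 1" for vs
  proof -
    obtain P where P: "subspace P" "set vs \<subseteq> P" "dim P = CARD('n)"
      using ex_superspace[of "set vs" "CARD('n)"] vs(1) card_length[of vs] by auto
    obtain e where e: "orthonormal_list e" "length e = CARD('n)" "span (set e) = P"
      "\<And>i j. i < CARD('n) \<Longrightarrow> j < CARD('n) \<Longrightarrow> i \<noteq> j \<Longrightarrow> inner (snd (e ! i)) (snd (e ! j)) = 0"
      using ex_split_frame[OF P(1,3)] by blast
    have "\<bar>Determinant.det (frame_mat vs e)\<bar> = 1"
      using gram_frame[OF e(1,2) vs(1)] e(3) P(2) vs(2) by (simp add: simple_norm_def)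
    then show ?thesis
      using \<Theta>_frame[OF e(1,2) vs(1)] e(3) P(2) \<Theta>_split_frame(1)[OF S e(1,2,4)] by (simp add: abs_mult)
  qed
  ultimately show ?thesis unfolding comass_def by (intro cSup_eq_maximum) auto
qed

lemma calibrated_unique:
  assumes S: "tw_S ls < 1" and P: "oriented_plane CARD('n) P" "form_value \<Theta> P = 1"
  shows "P = graph_plane A"
proof -
  have sub: "subspace (fst P)" and dim: "dim (fst P) = CARD('n)" using P(1) by (auto simp: oriented_plane_def)
  obtain bs where sP: "snd P = {cs. ordered_basis (fst P) cs \<and> same_orientation bs cs}"
    using P(1) by (auto simp: oriented_plane_def)
  define es where "es = (SOME es. es \<in> snd P \<and> orthonormal_list es)"
  have es: "es \<in> snd P" "orthonormal_list es"
    using someI_ex[OF oriented_plane_orthonormal[OF P(1)]] by (simp_all add: es_def)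
  have \<Theta>1: "\<Theta> es = 1" using P(2) by (simp add: form_value_def es_def)
  have b: "ordered_basis (fst P) es" using es(1) sP by simp
  have len: "length es = CARD('n)" using ordered_basis_length[OF b] dim by simp
  obtain e where e: "orthonormal_list e" "length e = CARD('n)" "span (set e) = fst P"
    "\<And>i j. i < CARD('n) \<Longrightarrow> j < CARD('n) \<Longrightarrow> i \<noteq> j \<Longrightarrow> inner (snd (e ! i)) (snd (e ! j)) = 0"
    using ex_split_frame[OF sub dim] by blast
  have "set es \<subseteq> span (set e)" using ordered_basis_in[OF b] e(3) by simp
  \<comment> \<open>The split frame may have the wrong orientation, so only the absolute value is
    known.\<close>
  then have "\<bar>\<Theta> e\<bar> = 1"
    using \<Theta>_frame[OF e(1,2) len] frame_mat_orthogonal(2)[OF es(2) e(1) len e(2)] \<Theta>1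
    by (metis abs_mult abs_one mult_1)
  then have "snd (e ! k) = A (fst (e ! k))" if "k < CARD('n)" for k
    using \<Theta>_split_frame(2)[OF S e(1,2,4)] that by blast
  then have "snd w = A (fst w)" if "w \<in> set e" for w
    using that e(2) by (auto simp only: in_set_conv_nth)
  then have "set e \<subseteq> \<Gamma>" unfolding subset_iff in_graph by blast
  then have fst: "fst P = \<Gamma>"
    using orthonormal_list_span[OF e(1) graph_subspace(1)] graph_subspace(2) e(2,3) by simp
  have "\<Theta> es = tw_C ls * Determinant.det (xmat es)"
    using \<Theta>_graph_subset[OF len] ordered_basis_in[OF b] fst by simp
  \<comment> \<open>The positive value excludes the opposite orientation of the graph.\<close>
  then have "0 < Determinant.det (xmat es)"
    using \<Theta>1 tw_C_lam(2) zero_less_mult_iff[of "tw_C ls" "Determinant.det (xmat es)"] by auto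
  then have "snd (graph_plane A) = {cs. ordered_basis \<Gamma> cs \<and> same_orientation es cs}"
    using snd_graph_plane_frame b fst by simp
  also have "\<dots> = snd P"
    using es(1) same_orientation_trans same_orientation_sym unfolding sP fst by blast
  finally show ?thesis using fst snd_graph_plane(2) by (metis prod.collapse)
qed

end

theorem proposition4p4:
  fixes D :: "(real ^ 'n::{finite,linorder}) set"
    and F :: "real ^ 'n::_ \<Rightarrow> real ^ 'm"
    and x :: "real ^ 'n::_" and y :: "real ^ 'm"
    and A :: "real ^ 'n::_ \<Rightarrow> real ^ 'm"
    and ls :: "real list"
    and \<Theta> :: "((real ^ 'n::_) \<times> (real ^ 'm)) form"
  assumes "open D"
    and "smooth_map_on F D"
    and "(x, y) \<in> D \<times> UNIV"
    and "A = frechet_derivative F (at x)"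
    and "nonzero_singular_values A ls"
    and "\<Theta> = tsai_wang_form F (x, y)"
    and "tw_S ls < 1"
  shows "calibrated_plane CARD('n) \<Theta> (graph_plane A) \<and>
    (\<forall>P. oriented_plane CARD('n) P \<and> form_value \<Theta> P = 1 \<longrightarrow> P = graph_plane A)"
proof -
  have "Ck_on (Suc 0) F D" using assms(2) by (simp add: smooth_map_on_def del: Ck_on.simps)
  then have "F differentiable (at x)" using assms(3) by simp
  then have lin: "linear A" unfolding assms(4) by (rule linear_frechet_derivative)
  \<comment> \<open>This repeats the choice inside \<open>tsai_wang_form\<close>, so that the locale
    is interpreted in exactly the coordinates that define the form.\<close>
  define t where "t = (SOME (xs, ys, ls). adapted_coordinates A xs ys ls)"
  obtain xs ys ls' where t: "t = (xs, ys, ls')" by (cases t)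
  have "case t of (xs, ys, ls) \<Rightarrow> adapted_coordinates A xs ys ls"
    unfolding t_def by (rule someI_ex) (use ex_adapted_coordinates[OF lin] in auto)
  then have "adapted_coordinates A xs ys ls'" by (simp add: t)
  then interpret tw_coordinates A xs ys ls' by (rule tw_coordinates.intro[OF lin])
  have "tw_S ls' < 1" using tw_S_unique[OF singular_values assms(5)] assms(7) by simp
  moreover have "\<Theta> = tw_form_in_coordinates xs ys ls'"
    unfolding assms(6) tsai_wang_form_def using t by (simp add: t_def assms(4))
  ultimately show ?thesis
    using comass_\<Theta> oriented_graph_plane form_value_graph_plane calibrated_unique
    unfolding calibrated_plane_def \<Theta>_def by blast
qed

end
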